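(* Let $E$ be a Banach space. For $p\in[1,\infty]\setminus\{2\}$ the set $L^p\text{-}\mathrm{PIso}(E)$ of $L^p$-partial isometries on $E$ is an inverse semigroup (under composition) whose set of idempotents is the set $\mathbb P_p(E)$ of $L^p$-projections on $E$. Passing to duals yields an injective antimultiplicative map $L^p\text{-}\mathrm{PIso}(E)\ni P\mapsto P'\in L^q\text{-}\mathrm{PIso}(E')$, where $1/p+1/q=1$.
   Context: Banach spaces are over $\mathbb F\in\{\mathbb R,\mathbb C\}$; $E'$ is the dual space, $P'$ the adjoint operator, $1/\infty=0$. An $L^p$-projection on $E$ is an idempotent $P\in B(E)$ with $\|\xi\|^p=\|P\xi\|^p+\|(1-P)\xi\|^p$ for all $\xi\in E$ if $p<\infty$, and $\|\xi\|=\max\{\|P\xi\|,\|(1-P)\xi\|\}$ for all $\xi\in E$ if $p=\infty$. An $L^p$-partial isometry on $E$ is a contraction $T\in B(E)$ that has a contractive generalized inverse $T^*\in B(E)$ (i.e. $TT^*T=T$, $T^*TT^*=T^*$) such that $TT^*$ and $T^*T$ are $L^p$-projections. *)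

theory Defs
  imports "HOL-Analysis.Analysis"
begin

text \<open>
  The axiom says that the field is isometrically isomorphic to the reals or to the
  complex numbers; it allows both cases to be treated uniformly.
\<close>
class real_or_complex = real_normed_field + banach +
  assumes real_or_complex:
    "(\<forall>x. \<exists>a. x = a *\<^sub>R 1) \<or>
     (\<exists>i. i * i = - 1 \<and>
        (\<forall>x. \<exists>a b. x = a *\<^sub>R 1 + b *\<^sub>R i \<and> norm x = sqrt (a\<^sup>2 + b\<^sup>2)))"

instance real :: real_or_complex
  by standard auto

instance complex :: real_or_complex
proof
  have "x = Re x *\<^sub>R 1 + Im x *\<^sub>R \<i> \<and> norm x = sqrt ((Re x)\<^sup>2 + (Im x)\<^sup>2)"
    for x :: complex
    by (simp add: complex_eq_iff cmod_def)
  then show "(\<forall>x::complex. \<exists>a. x = a *\<^sub>R 1) \<or>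
     (\<exists>i::complex. i * i = - 1 \<and>
        (\<forall>x. \<exists>a b. x = a *\<^sub>R 1 + b *\<^sub>R i \<and> norm x = sqrt (a\<^sup>2 + b\<^sup>2)))"
    using i_squared by blast
qed

text \<open>
  A Banach space over \<open>'k\<close> is a type in the library class \<open>banach\<close> with a multiplication
  by scalars from \<open>'k\<close> that extends the real one and for which the norm is homogeneous.
\<close>
locale banach_space_over = vector_space scal
  for scal :: "'k::real_or_complex \<Rightarrow> 'a::banach \<Rightarrow> 'a" +
  assumes scal_of_real: "scal (of_real r) x = r *\<^sub>R x"
    and norm_scal: "norm (scal c x) = norm c * norm x"

text \<open>
  The library's space \<open>'a \<Rightarrow>\<^sub>L 'k\<close> consists of the real-linear bounded maps. The dual space is
  its subspace of \<open>'k\<close>-linear functionals, so it is a subset rather than a type, with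
  the operator norm inherited from \<open>'a \<Rightarrow>\<^sub>L 'k\<close>. For this reason operators are
  considered below on a carrier set \<open>V\<close>: it is \<open>UNIV\<close> for the space itself
  and \<open>dual scal\<close> for its dual.
\<close>
definition dual :: "('k::real_or_complex \<Rightarrow> 'a::banach \<Rightarrow> 'a) \<Rightarrow> ('a \<Rightarrow>\<^sub>L 'k) set"
  where "dual scal = {f. \<forall>c x. blinfun_apply f (scal c x) = c * blinfun_apply f x}"

definition dual_scal :: "'k::real_or_complex \<Rightarrow> ('a::banach \<Rightarrow>\<^sub>L 'k) \<Rightarrow> ('a \<Rightarrow>\<^sub>L 'k)"
  where "dual_scal c f = blinfun_mult_right c o\<^sub>L f"

text \<open>Operators on \<open>V\<close> are \<open>extensional\<close>, so that equality of operators is equality on \<open>V\<close>;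
  their product is \<open>compose V\<close>.\<close>

definition bounded_operators ::
    "('k \<Rightarrow> 'v \<Rightarrow> 'v) \<Rightarrow> 'v::real_normed_vector set \<Rightarrow> ('v \<Rightarrow> 'v) set"
  where "bounded_operators scal V =
    {T \<in> V \<rightarrow>\<^sub>E V.
       (\<forall>x\<in>V. \<forall>y\<in>V. T (x + y) = T x + T y) \<and>
       (\<forall>c. \<forall>x\<in>V. T (scal c x) = scal c (T x)) \<and>
       (\<exists>K. \<forall>x\<in>V. norm (T x) \<le> K * norm x)}"

definition contractions ::
    "('k \<Rightarrow> 'v \<Rightarrow> 'v) \<Rightarrow> 'v::real_normed_vector set \<Rightarrow> ('v \<Rightarrow> 'v) set"
  where "contractions scal V =
    {T \<in> bounded_operators scal V. \<forall>x\<in>V. norm (T x) \<le> norm x}"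

definition Lp_projections ::
    "ereal \<Rightarrow> ('k \<Rightarrow> 'v \<Rightarrow> 'v) \<Rightarrow> 'v::real_normed_vector set \<Rightarrow> ('v \<Rightarrow> 'v) set"
  where "Lp_projections p scal V =
    {P \<in> bounded_operators scal V.
       compose V P P = P \<and>
       (\<forall>x\<in>V. if p = \<infinity> then norm x = max (norm (P x)) (norm (x - P x))
              else norm x powr real_of_ereal p =
                   norm (P x) powr real_of_ereal p + norm (x - P x) powr real_of_ereal p)}"

definition Lp_PIso ::
    "ereal \<Rightarrow> ('k \<Rightarrow> 'v \<Rightarrow> 'v) \<Rightarrow> 'v::real_normed_vector set \<Rightarrow> ('v \<Rightarrow> 'v) set"
  where "Lp_PIso p scal V =
    {T \<in> contractions scal V.
       \<exists>S \<in> contractions scal V.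
         compose V T (compose V S T) = T \<and>
         compose V S (compose V T S) = S \<and>
         compose V T S \<in> Lp_projections p scal V \<and>
         compose V S T \<in> Lp_projections p scal V}"

definition adjoint_operator ::
    "('k::real_or_complex \<Rightarrow> 'a::banach \<Rightarrow> 'a) \<Rightarrow> ('a \<Rightarrow> 'a) \<Rightarrow> ('a \<Rightarrow>\<^sub>L 'k) \<Rightarrow> ('a \<Rightarrow>\<^sub>L 'k)"
  where "adjoint_operator scal T = (\<lambda>f \<in> dual scal. Blinfun (\<lambda>x. blinfun_apply f (T x)))"

definition inverse_semigroup :: "'s set \<Rightarrow> ('s \<Rightarrow> 's \<Rightarrow> 's) \<Rightarrow> bool"
  where "inverse_semigroup S mul \<longleftrightarrow>
    S \<noteq> {} \<and>
    (\<forall>s\<in>S. \<forall>t\<in>S. mul s t \<in> S) \<and>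
    (\<forall>s\<in>S. \<forall>t\<in>S. \<forall>u\<in>S. mul (mul s t) u = mul s (mul t u)) \<and>
    (\<forall>s\<in>S. \<exists>!t. t \<in> S \<and> mul (mul s t) s = s \<and> mul (mul t s) t = t)"

lemma dual_scal_apply [simp]: "blinfun_apply (dual_scal c f) x = c * blinfun_apply f x"
  by (simp add: dual_scal_def)

lemma dual_closed:
  assumes "f \<in> dual scal" "g \<in> dual scal"
  shows "0 \<in> dual scal" "f + g \<in> dual scal" "f - g \<in> dual scal" "dual_scal c f \<in> dual scal"
  using assms by (auto simp: dual_def blinfun.bilinear_simps algebra_simps)

lemma norm_dual_scal:
  fixes c :: "'k::real_or_complex" and f :: "'a::banach \<Rightarrow>\<^sub>L 'k"
  shows "norm (dual_scal c f) = norm c * norm f"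
proof (cases "c = 0")
  case True
  then have "dual_scal c f = 0"
    by (intro blinfun_eqI) simp
  with True show ?thesis by simp
next
  case False
  have le: "norm (dual_scal d g) \<le> norm d * norm g" for d :: 'k and g :: "'a \<Rightarrow>\<^sub>L 'k"
    by (rule norm_blinfun_bound)
       (auto simp: norm_mult mult.assoc intro!: mult_left_mono norm_blinfun)
  have "f = dual_scal (inverse c) (dual_scal c f)"
    using False by (intro blinfun_eqI) (simp add: mult.assoc [symmetric])
  then have "norm f \<le> norm (inverse c) * norm (dual_scal c f)"
    using le by metis
  then have "norm c * norm f \<le> norm (dual_scal c f)"
    using False by (simp add: norm_divide field_simps)
  with le show ?thesis by (simp add: antisym)
qed

lemma complete_dual: "complete (dual scal)"
proof -
  have "dual scal = (\<Inter>c. \<Inter>x. {f. blinfun_apply f (scal c x) = c * blinfun_apply f x})"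
    by (auto simp: dual_def)
  moreover have "closed {f. blinfun_apply f (scal c x) = c * blinfun_apply f x}" for c x
    by (intro closed_Collect_eq continuous_intros)
  ultimately show ?thesis
    by (simp add: complete_eq_closed closed_INT)
qed

context banach_space_over
begin

lemma bounded_linear_bounded_operator:
  assumes "T \<in> bounded_operators scal UNIV"
  shows "bounded_linear T"
proof -
  from assms obtain K where K: "\<And>x. norm (T x) \<le> K * norm x"
    and add: "\<And>x y. T (x + y) = T x + T y"
    and sc: "\<And>c x. T (scal c x) = scal c (T x)"
    unfolding bounded_operators_def by auto
  have "T (r *\<^sub>R x) = r *\<^sub>R T x" for r x
    using sc [of "of_real r" x] by (simp add: scal_of_real)
  with K add show ?thesis
    by (intro bounded_linear_intro [where K = K]) (auto simp: mult.commute)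
qed

lemma adjoint_operator_apply:
  assumes "T \<in> bounded_operators scal UNIV" "f \<in> dual scal"
  shows "blinfun_apply (adjoint_operator scal T f) x = blinfun_apply f (T x)"
  using assms bounded_linear_bounded_operator [OF assms(1)]
  by (simp add: adjoint_operator_def bounded_linear_Blinfun_apply
      bounded_linear_compose [OF blinfun.bounded_linear_right])

lemma adjoint_operator_bounded:
  assumes T: "T \<in> bounded_operators scal UNIV"
  shows "adjoint_operator scal T \<in> bounded_operators dual_scal (dual scal)"
proof -
  note app = adjoint_operator_apply [OF T]
  have sc: "T (scal c x) = scal c (T x)" for c x
    using T by (auto simp: bounded_operators_def)
  have map: "adjoint_operator scal T f \<in> dual scal" if "f \<in> dual scal" for f
    using that by (simp add: dual_def app [OF that] sc)
  from T obtain K0 where K0: "\<And>x. norm (T x) \<le> K0 * norm x"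
    unfolding bounded_operators_def by auto
  define K where "K = max K0 0"
  have K: "norm (T x) \<le> K * norm x" and "0 \<le> K" for x
    using K0 [of x] mult_right_mono [of K0 K "norm x"] by (auto simp: K_def)
  have bd: "norm (adjoint_operator scal T f) \<le> K * norm f" if "f \<in> dual scal" for f
  proof (rule norm_blinfun_bound)
    show "0 \<le> K * norm f" using \<open>0 \<le> K\<close> by simp
    fix x
    have "norm (blinfun_apply f (T x)) \<le> norm f * norm (T x)"
      by (rule norm_blinfun)
    also have "\<dots> \<le> norm f * (K * norm x)"
      by (intro mult_left_mono K) simp
    finally show "norm (blinfun_apply (adjoint_operator scal T f) x) \<le> K * norm f * norm x"
      by (simp add: app [OF that] mult.commute mult.left_commute)
  qed
  have "adjoint_operator scal T \<in> extensional (dual scal)"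
    by (simp add: adjoint_operator_def)
  moreover have "adjoint_operator scal T (f + g) = adjoint_operator scal T f + adjoint_operator scal T g"
    if "f \<in> dual scal" "g \<in> dual scal" for f g
    using that by (intro blinfun_eqI) (simp add: app dual_closed blinfun.bilinear_simps)
  moreover have "adjoint_operator scal T (dual_scal c f) = dual_scal c (adjoint_operator scal T f)"
    if "f \<in> dual scal" for c f
    using that by (intro blinfun_eqI) (simp add: app dual_closed)
  ultimately show ?thesis
    using map bd unfolding bounded_operators_def PiE_def by blast
qed

end

end

theory Submission
  imports Defs
begin

text \<open>
  The statement rests on the fact that any two \<open>L\<^sup>p\<close>-projections \<open>P\<close>, \<open>Q\<close> on a Banach space commute if
  \<open>p \<noteq> 2\<close> (\<open>Lp_projections_commute\<close>). For \<open>p < 2\<close> this is a matter of convexity: for \<open>x\<close> in the range of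
  \<open>Q\<close>, the function \<open>t \<mapsto> norm (x + t *\<^sub>R Q (P x)) ^ p\<close> is the sum of a function that is smooth near 0
  and of \<open>- \<bar>t\<bar> ^ p * norm (P x - Q (P x)) ^ p\<close>. The latter would destroy convexity at 0 unless it
  vanishes, so \<open>P\<close> maps the range of \<open>Q\<close> into itself, and likewise the range of \<open>1 - Q\<close>
  (\<open>Lp_projection_preserves_range\<close>).

  The case \<open>p > 2\<close> follows by duality. The adjoint of an \<open>L\<^sup>p\<close>-projection is an \<open>L\<^sup>q\<close>-projection
  (\<open>adjoint_Lp_projection\<close>), because the l^p and l^q norms on the plane are dual to each other: Hoelder's
  inequality bounds the norm of a functional from above and the equality case bounds it from below.
  Since \<open>q < 2\<close>, the adjoints commute. An operator is determined by its adjoint (\<open>adjoint_inject\<close>),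
  as bounded linear functionals separate points. This instance of the Hahn-Banach theorem is proved
  by observing that a minimal sublinear functional is linear (\<open>exists_norming_functional\<close>).

  Everything else is algebra. Let \<open>S\<^sub>1\<close>, \<open>S\<^sub>2\<close> be generalized inverses of the partial isometries \<open>T\<^sub>1\<close>,
  \<open>T\<^sub>2\<close>. Since the projections \<open>T\<^sub>2 S\<^sub>2\<close> and \<open>S\<^sub>1 T\<^sub>1\<close> commute, \<open>S\<^sub>2 S\<^sub>1\<close> is a generalized
  inverse of \<open>T\<^sub>1 T\<^sub>2\<close>, and conjugation by a partial isometry preserves \<open>L\<^sup>p\<close>-projections
  (\<open>Lp_projection_conjugate\<close>), so \<open>T\<^sub>1 T\<^sub>2\<close> is a partial isometry. The idempotents are exactly the
  \<open>L\<^sup>p\<close>-projections (\<open>idempotents_Lp_PIso\<close>); they commute, which makes generalized inverses unique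
  (\<open>inverse_semigroupI\<close>). Taking adjoints reverses products, preserves contractions and turns
  \<open>L\<^sup>p\<close>-projections into \<open>L\<^sup>q\<close>-projections, hence it maps partial isometries to partial isometries.
\<close>

section \<open>Two-term l^p sums and Hoelder duality\<close>

text \<open>
  The norm of the vector (a, b) in the plane with the l^p norm. The power identity for \<open>p < \<infinity>\<close> and
  the maximum for \<open>p = \<infinity>\<close> both become \<open>norm x = lp_sum p (norm (P x)) (norm (x - P x))\<close>, so that
  only a few lemmas about \<open>lp_sum\<close> have to distinguish the two cases.
\<close>
definition lp_sum :: "ereal \<Rightarrow> real \<Rightarrow> real \<Rightarrow> real"
  where "lp_sum p a b =
    (if p = \<infinity> then max a b
     else (a powr real_of_ereal p + b powr real_of_ereal p) powr (1 / real_of_ereal p))"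

lemma lp_sum_cases:
  fixes p :: ereal
  assumes "1 \<le> p"
  obtains "p = \<infinity>" | r where "p = ereal r" "1 \<le> r"
  using assms by (cases p) (auto simp: one_ereal_def)

lemma lp_sum_ereal: "lp_sum (ereal r) a b = (a powr r + b powr r) powr (1 / r)"
  by (simp add: lp_sum_def)

lemma lp_sum_infinity: "lp_sum \<infinity> a b = max a b"
  by (simp add: lp_sum_def)

lemma lp_sum_powr:
  assumes "1 \<le> r"
  shows "lp_sum (ereal r) a b powr r = a powr r + b powr r"
  using assms by (simp add: lp_sum_ereal powr_powr)

lemma lp_sum_eqI:
  assumes "1 \<le> r" "0 \<le> c" "c powr r = a powr r + b powr r"
  shows "c = lp_sum (ereal r) a b"
  using assms by (simp add: lp_sum_ereal flip: assms(3)) (simp add: powr_powr)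

lemma lp_sum_eq_iff:
  assumes "1 \<le> r" "0 \<le> c"
  shows "c = lp_sum (ereal r) a b \<longleftrightarrow> c powr r = a powr r + b powr r"
  using assms lp_sum_eqI lp_sum_powr by metis

lemma lp_sum_nonneg: "0 \<le> a \<Longrightarrow> 0 \<le> lp_sum p a b"
  by (simp add: lp_sum_def le_max_iff_disj)

lemma lp_sum_commute: "lp_sum p a b = lp_sum p b a"
  by (simp add: lp_sum_def add.commute max.commute)

lemma lp_sum_assoc:
  assumes "1 \<le> p"
  shows "lp_sum p (lp_sum p a b) c = lp_sum p a (lp_sum p b c)"
  using assms
proof (cases rule: lp_sum_cases)
  case (2 r)
  then show ?thesis
    unfolding lp_sum_ereal [of r "lp_sum _ _ _"] lp_sum_ereal [of r a "lp_sum _ _ _"] 2(1)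
    by (simp add: lp_sum_powr add.assoc)
qed (simp add: lp_sum_infinity max.assoc)

lemma lp_sum_zero:
  assumes "1 \<le> p" "0 \<le> a"
  shows "lp_sum p a 0 = a" "lp_sum p 0 a = a"
  using assms by (auto elim!: lp_sum_cases simp: lp_sum_infinity lp_sum_ereal powr_powr)

lemma lp_sum_mono:
  assumes "1 \<le> p" "0 \<le> a" "0 \<le> b" "a \<le> a'" "b \<le> b'"
  shows "lp_sum p a b \<le> lp_sum p a' b'"
  using assms(1)
proof (cases rule: lp_sum_cases)
  case 1
  then show ?thesis using assms by (simp add: lp_sum_infinity) linarith
next
  case (2 r)
  then show ?thesis
    using assms by (auto simp: lp_sum_ereal intro!: powr_mono2 add_mono)
qed

lemma lp_sum_ge:
  assumes "1 \<le> p" "0 \<le> a" "0 \<le> b"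
  shows "a \<le> lp_sum p a b" "b \<le> lp_sum p a b"
  using lp_sum_mono [of p a 0 a b] lp_sum_mono [of p 0 b a b] assms
  by (auto simp: lp_sum_zero)

lemma lp_sum_mult:
  assumes "1 \<le> p" "0 \<le> c" "0 \<le> a" "0 \<le> b"
  shows "lp_sum p (c * a) (c * b) = c * lp_sum p a b"
  using assms(1)
proof (cases rule: lp_sum_cases)
  case 1
  then show ?thesis using assms by (simp add: lp_sum_infinity max_mult_distrib_left)
next
  case (2 r)
  then show ?thesis
    using assms
    by (simp add: lp_sum_ereal powr_mult powr_powr flip: distrib_left)
qed

lemma conjugate_exponent_cases:
  fixes p q :: ereal
  assumes "1 \<le> p" "1 \<le> q" "1 / p + 1 / q = 1"
  obtains "p = 1" "q = \<infinity>" | "p = \<infinity>" "q = 1"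
    | r s where "p = ereal r" "q = ereal s" "1 < r" "1 < s" "1 / r + 1 / s = 1"
proof -
  consider "p = \<infinity>" | r where "p = ereal r" "1 \<le> r"
    using assms(1) by (rule lp_sum_cases)
  then show ?thesis
  proof cases
    case 1
    with assms have "q = 1"
      by (cases q) (auto simp: one_ereal_def)
    with 1 that show ?thesis by blast
  next
    case (2 r)
    show ?thesis
      using assms(2)
    proof (cases rule: lp_sum_cases)
      case 1
      with assms 2 have "p = 1"
        by (auto simp: one_ereal_def)
      with 1 that show ?thesis by blast
    next
      case (2 s)
      have eq: "1 / r + 1 / s = 1"
        using assms(3) \<open>p = _\<close> \<open>q = _\<close> \<open>1 \<le> r\<close> \<open>1 \<le> s\<close> by (simp add: one_ereal_def)
      have "1 / r > 0" "1 / s > 0" using \<open>1 \<le> r\<close> \<open>1 \<le> s\<close> by auto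
      with eq have "1 / r < 1" "1 / s < 1" by linarith+
      then have "1 < r" "1 < s" using \<open>1 \<le> r\<close> \<open>1 \<le> s\<close> by auto
      with eq that(3) \<open>p = _\<close> \<open>q = _\<close> show ?thesis by blast
    qed
  qed
qed

lemma lp_sum_1: "0 \<le> a \<Longrightarrow> 0 \<le> b \<Longrightarrow> lp_sum 1 a b = a + b"
  by (simp add: one_ereal_def lp_sum_ereal)

lemma lp_sum_normalized:
  assumes "1 \<le> r" "0 \<le> a" "0 \<le> b" "0 < lp_sum (ereal r) a b"
  shows "(a / lp_sum (ereal r) a b) powr r + (b / lp_sum (ereal r) a b) powr r = 1"
proof -
  have "(a / lp_sum (ereal r) a b) powr r + (b / lp_sum (ereal r) a b) powr r
      = lp_sum (ereal r) a b powr r / lp_sum (ereal r) a b powr r"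
    using assms lp_sum_powr [of r a b] by (simp add: powr_divide flip: add_divide_distrib)
  with assms(4) show ?thesis by simp
qed

text \<open>
  For finite exponents above 1 the vectors are normalised and Young's inequality is applied in
  each coordinate.
\<close>
lemma lp_sum_Hoelder:
  fixes p q :: ereal
  assumes pq: "1 \<le> p" "1 \<le> q" "1 / p + 1 / q = 1"
    and nonneg: "0 \<le> a" "0 \<le> b" "0 \<le> c" "0 \<le> d"
  shows "a * c + b * d \<le> lp_sum p a b * lp_sum q c d"
  using pq
proof (cases rule: conjugate_exponent_cases)
  case 1
  have "a * c + b * d \<le> a * max c d + b * max c d"
    using nonneg by (intro add_mono mult_left_mono) auto
  with 1 nonneg show ?thesis
    by (simp add: lp_sum_1 lp_sum_infinity distrib_right)
next
  case 2
  have "a * c + b * d \<le> max a b * c + max a b * d"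
    using nonneg by (intro add_mono mult_right_mono) auto
  with 2 nonneg show ?thesis
    by (simp add: lp_sum_1 lp_sum_infinity distrib_left)
next
  case (3 r s)
  define M N where "M = lp_sum p a b" and "N = lp_sum q c d"
  have MN: "0 \<le> M" "0 \<le> N" "a \<le> M" "b \<le> M" "c \<le> N" "d \<le> N"
    using nonneg pq by (auto simp: M_def N_def lp_sum_nonneg lp_sum_ge)
  show ?thesis
  proof (cases "M = 0 \<or> N = 0")
    case True
    with MN nonneg have "a = 0 \<and> b = 0 \<or> c = 0 \<and> d = 0" by linarith
    then have "a * c + b * d = 0" by auto
    with True show ?thesis by (auto simp: M_def N_def)
  next
    case False
    with MN have pos: "0 < M" "0 < N" by auto
    have young: "u / M * (v / N) \<le> (u / M) powr r / r + (v / N) powr s / s"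
      if "0 \<le> u" "0 \<le> v" for u v
      using 3 that pos by (intro Youngs_inequality) auto
    have M1: "(a / M) powr r + (b / M) powr r = 1"
      using pos nonneg 3 by (simp add: M_def lp_sum_normalized)
    have N1: "(c / N) powr s + (d / N) powr s = 1"
      using pos nonneg 3 by (simp add: N_def lp_sum_normalized)
    have "a / M * (c / N) + b / M * (d / N)
        \<le> ((a / M) powr r + (b / M) powr r) / r + ((c / N) powr s + (d / N) powr s) / s"
      using young [of a c] young [of b d] nonneg by (simp add: add_divide_distrib)
    also have "\<dots> = 1" using 3 by (simp add: M1 N1)
    finally have "(a * c + b * d) / (M * N) \<le> 1"
      by (simp add: add_divide_distrib)
    then show ?thesis using pos by (simp add: M_def N_def)
  qed
qed

text \<open>
  The planes with the l^p and the l^q norm are dual to each other isometrically: Hoelder's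
  inequality is sharp. This is what makes the norm identity of an adjoint projection an equality.
\<close>
lemma lp_sum_Hoelder_attained:
  fixes p q :: ereal
  assumes pq: "1 \<le> p" "1 \<le> q" "1 / p + 1 / q = 1"
    and nonneg: "0 \<le> a" "0 \<le> b"
  obtains \<alpha> \<beta> where "0 \<le> \<alpha>" "0 \<le> \<beta>" "lp_sum p \<alpha> \<beta> \<le> 1" "\<alpha> * a + \<beta> * b = lp_sum q a b"
  using pq
proof (cases rule: conjugate_exponent_cases)
  case 1
  show thesis
  proof (cases "a \<le> b")
    case True
    with 1 nonneg show thesis
      by (intro that [of 0 1]) (auto simp: lp_sum_infinity lp_sum_1)
  next
    case False
    with 1 nonneg show thesis
      by (intro that [of 1 0]) (auto simp: lp_sum_infinity lp_sum_1)
  qed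
next
  case 2
  with nonneg show thesis
    by (intro that [of 1 1]) (auto simp: lp_sum_infinity lp_sum_1)
next
  case (3 r s)
  define M where "M = lp_sum q a b"
  have M: "0 \<le> M" "a \<le> M" "b \<le> M"
    using nonneg pq by (auto simp: M_def lp_sum_nonneg lp_sum_ge)
  show thesis
  proof (cases "M = 0")
    case True
    with M nonneg show thesis
      by (intro that [of 0 0]) (auto simp: M_def lp_sum_zero pq)
  next
    case False
    with M have pos: "0 < M" by auto
    have M1: "(a / M) powr s + (b / M) powr s = 1"
      using pos nonneg 3 by (simp add: M_def lp_sum_normalized)
    have exponent: "(s - 1) * r = s"
      using 3 by (simp add: field_simps)
    have weight: "u powr (s - 1) * u = u powr s" if "0 \<le> u" for u :: real
      using that powr_mult_base [of u "s - 1"] by (simp add: mult.commute)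
    \<comment> \<open>The extremal vector for (a, b) has coordinates proportional to the powers with exponent s - 1.\<close>
    have "lp_sum p ((a / M) powr (s - 1)) ((b / M) powr (s - 1)) = 1"
      using 3 by (simp add: lp_sum_ereal powr_powr exponent M1)
    moreover have "(a / M) powr (s - 1) * a + (b / M) powr (s - 1) * b
        = M * ((a / M) powr (s - 1) * (a / M) + (b / M) powr (s - 1) * (b / M))"
      using pos by (simp add: distrib_left)
    then have "(a / M) powr (s - 1) * a + (b / M) powr (s - 1) * b = M"
      using M nonneg by (simp only: weight divide_nonneg_nonneg M1 mult_1_right)
    ultimately show thesis
      by (intro that) (auto simp: M_def)
  qed
qed

section \<open>Separating points by functionals\<close>

definition sublinear :: "('a::real_vector \<Rightarrow> real) \<Rightarrow> bool"
  where "sublinear s \<longleftrightarrow>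
    (\<forall>x y. s (x + y) \<le> s x + s y) \<and> (\<forall>r x. 0 \<le> r \<longrightarrow> s (r *\<^sub>R x) = r * s x)"

lemma sublinear_zero: "sublinear s \<Longrightarrow> s 0 = 0"
  unfolding sublinear_def by (metis mult_zero_left order_refl scaleR_zero_left)

lemma sublinear_minus:
  assumes "sublinear s"
  shows "- s (- x) \<le> s x"
proof -
  have "s (x + - x) \<le> s x + s (- x)"
    using assms unfolding sublinear_def by blast
  with sublinear_zero [OF assms] show ?thesis by simp
qed

text \<open>
  The largest decrease of \<open>s\<close> along \<open>y\<close>: since \<open>s (x + t *\<^sub>R y) - t * s y\<close> is at most \<open>s x\<close> and
  decreases in \<open>t\<close>, its infimum is again sublinear, lies below \<open>s\<close>, and is linear along \<open>y\<close>.
\<close>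
lemma sublinear_flatten:
  assumes s: "sublinear s"
  obtains s' where "sublinear s'" "\<And>x. s' x \<le> s x" "s' (- y) \<le> - s y"
proof -
  have add: "s (u + v) \<le> s u + s v" and hom: "0 \<le> r \<Longrightarrow> s (r *\<^sub>R u) = r * s u" for u v r
    using s by (auto simp: sublinear_def)
  define s' where "s' x = (INF t\<in>{0..}. s (x + t *\<^sub>R y) - t * s y)" for x
  have lower: "- s (- x) \<le> s (x + t *\<^sub>R y) - t * s y" if "0 \<le> t" for x t
    using add [of "x + t *\<^sub>R y" "- x"] hom [OF that, of y] by simp
  have bdd: "bdd_below ((\<lambda>t. s (x + t *\<^sub>R y) - t * s y) ` {0..})" for x
    using lower by (intro bdd_belowI2 [where m = "- s (- x)"]) auto
  have upper: "s' x \<le> s (x + t *\<^sub>R y) - t * s y" if "0 \<le> t" for x t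
    unfolding s'_def using that by (intro cINF_lower bdd) auto
  have great: "m \<le> s' x" if "\<And>t. 0 \<le> t \<Longrightarrow> m \<le> s (x + t *\<^sub>R y) - t * s y" for m x
    unfolding s'_def using that by (intro cINF_greatest) auto
  have sub: "s' (u + v) \<le> s' u + s' v" for u v
  proof -
    have "s' (u + v) - (s (v + t *\<^sub>R y) - t * s y) \<le> s' u" if t: "0 \<le> t" for t
    proof (rule great)
      fix r :: real assume r: "0 \<le> r"
      have "s' (u + v) \<le> s (u + v + (r + t) *\<^sub>R y) - (r + t) * s y"
        using r t by (intro upper) auto
      also have "\<dots> \<le> s (u + r *\<^sub>R y) + s (v + t *\<^sub>R y) - (r + t) * s y"
        using add [of "u + r *\<^sub>R y" "v + t *\<^sub>R y"] by (simp add: algebra_simps)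
      finally show "s' (u + v) - (s (v + t *\<^sub>R y) - t * s y) \<le> s (u + r *\<^sub>R y) - r * s y"
        by (simp add: algebra_simps)
    qed
    then have "s' (u + v) - s' u \<le> s' v"
      by (intro great) (smt (verit))
    then show ?thesis by simp
  qed
  have hom_le: "s' (r *\<^sub>R u) \<le> r * s' u" if r: "0 < r" for r u
  proof -
    have "s' (r *\<^sub>R u) / r \<le> s' u"
    proof (rule great)
      fix t :: real assume "0 \<le> t"
      then have "s' (r *\<^sub>R u) \<le> s (r *\<^sub>R u + (r * t) *\<^sub>R y) - (r * t) * s y"
        using r by (intro upper) auto
      also have "\<dots> = r * (s (u + t *\<^sub>R y) - t * s y)"
        using hom [of r "u + t *\<^sub>R y"] r by (simp add: algebra_simps)
      finally show "s' (r *\<^sub>R u) / r \<le> s (u + t *\<^sub>R y) - t * s y"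
        using r by (simp add: field_simps)
    qed
    then show ?thesis using r by (simp add: field_simps)
  qed
  have zero: "s' 0 = 0"
    using upper [of 0 0] great [of 0 0] hom sublinear_zero [OF s] by (intro antisym) auto
  have "s' (r *\<^sub>R u) = r * s' u" if "0 \<le> r" for r u
  proof (cases "r = 0")
    case False
    with that have r: "0 < r" by simp
    have "s' u \<le> inverse r * s' (r *\<^sub>R u)"
      using hom_le [of "inverse r" "r *\<^sub>R u"] r by simp
    then show ?thesis
      using hom_le [OF r, of u] r by (intro antisym) (auto simp: field_simps)
  qed (simp add: zero)
  with sub have "sublinear s'" by (auto simp: sublinear_def)
  moreover have "s' x \<le> s x" for x
    using upper [of 0 x] by simp
  moreover have "s' (- y) \<le> - s y"
    using upper [of 1 "- y"] sublinear_zero [OF s] by simp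
  ultimately show thesis by (rule that)
qed

text \<open>
  A minimal sublinear functional is fixed by flattening along every \<open>y\<close>, hence it is odd, and an
  odd subadditive functional is additive.
\<close>
lemma minimal_sublinear_linear:
  assumes s: "sublinear s"
    and minimal: "\<And>s'. sublinear s' \<Longrightarrow> (\<And>x. s' x \<le> s x) \<Longrightarrow> s' = s"
  shows "linear s"
proof -
  have neg: "s (- y) = - s y" for y
  proof -
    obtain s' where "sublinear s'" "\<And>x. s' x \<le> s x" "s' (- y) \<le> - s y"
      using sublinear_flatten [OF s, of y] by metis
    with minimal have "s (- y) \<le> - s y" by metis
    with sublinear_minus [OF s, of y] show ?thesis by simp
  qed
  have add: "s (u + v) \<le> s u + s v" and hom: "0 \<le> r \<Longrightarrow> s (r *\<^sub>R u) = r * s u" for u v r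
    using s by (auto simp: sublinear_def)
  have "s (u + v) = s u + s v" for u v
    using add [of u v] add [of "u + v" "- v"] by (simp add: neg)
  moreover have "s (r *\<^sub>R u) = r * s u" for r u
    using hom [of r u] hom [of "- r" u] by (cases "0 \<le> r") (auto simp: neg)
  ultimately show ?thesis by (auto intro!: linearI)
qed

text \<open>
  Zorn's lemma for the reversed pointwise order. The pointwise infimum of a chain exists because
  every sublinear \<open>s \<le> s0\<close> is bounded below by \<open>- s0 (- x)\<close>; it is subadditive because, of two
  members of a chain, the smaller one can be used at both points.
\<close>
lemma exists_minimal_sublinear:
  assumes s0: "sublinear s0"
  obtains s where "sublinear s" "\<And>x. s x \<le> s0 x"
    "\<And>s'. sublinear s' \<Longrightarrow> (\<And>x. s' x \<le> s x) \<Longrightarrow> s' = s"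
proof -
  define A where "A = {s. sublinear s \<and> (\<forall>x. s x \<le> s0 x)}"
  have low: "- s0 (- x) \<le> s x" if "s \<in> A" for s x
    using that sublinear_minus [of s x] unfolding A_def by (smt (verit) mem_Collect_eq)
  have "\<exists>m\<in>A. \<forall>a\<in>A. (\<lambda>s t. t \<le> s) m a \<longrightarrow> a = m"
  proof (rule predicate_Zorn)
    show "partial_order_on A (relation_of (\<lambda>s t. t \<le> s) A)"
      by (rule partial_order_on_relation_ofI) auto
  next
    fix C assume "C \<in> Chains (relation_of (\<lambda>s t. t \<le> s) A)"
    then have C: "C \<subseteq> A" and total: "\<And>s t. s \<in> C \<Longrightarrow> t \<in> C \<Longrightarrow> s \<le> t \<or> t \<le> s"
      by (auto simp: Chains_def relation_of_def)
    show "\<exists>u\<in>A. \<forall>a\<in>C. u \<le> a"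
    proof (cases "C = {}")
      case True
      with s0 show ?thesis by (auto simp: A_def)
    next
      case False
      define m where "m x = (INF s\<in>C. s x)" for x
      have upper: "m x \<le> s x" if "s \<in> C" for s x
        unfolding m_def using that C low
        by (intro cINF_lower bdd_belowI2 [where m = "- s0 (- x)"]) auto
      have great: "k \<le> m x" if "\<And>s. s \<in> C \<Longrightarrow> k \<le> s x" for k x
        unfolding m_def using that False by (intro cINF_greatest) auto
      have props: "s (u + v) \<le> s u + s v" "0 \<le> r \<Longrightarrow> s (r *\<^sub>R u) = r * s u" "s u \<le> s0 u"
        if "s \<in> C" for s u v r
        using that C by (auto simp: A_def sublinear_def)
      have "m (u + v) \<le> m u + m v" for u v
      proof -
        have "m (u + v) \<le> s u + t v" if "s \<in> C" "t \<in> C" for s t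
          using total [OF that] upper [OF that(1), of "u + v"] upper [OF that(2), of "u + v"]
            props(1) [OF that(1), of u v] props(1) [OF that(2), of u v]
          by (smt (verit) le_funD)
        then have "m (u + v) - t v \<le> m u" if "t \<in> C" for t
          using that by (intro great) (simp add: diff_le_eq)
        then have "m (u + v) - m u \<le> m v"
          by (intro great) (smt (verit))
        then show ?thesis by simp
      qed
      moreover have "m (r *\<^sub>R u) = r * m u" if "0 \<le> r" for r u
      proof (cases "r = 0")
        case True
        have zero: "s 0 = 0" if "s \<in> C" for s
          using props(2) [OF that, of 0 0] by simp
        obtain s where "s \<in> C" using \<open>C \<noteq> {}\<close> by blast
        then have "m 0 \<le> 0" using upper [of s 0] zero [of s] by linarith
        moreover have "0 \<le> m 0" by (intro great) (metis zero order_refl)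
        ultimately show ?thesis using True by simp
      next
        case False
        with that have r: "0 < r" by simp
        have "m (r *\<^sub>R u) / r \<le> m u"
        proof (rule great)
          fix s assume "s \<in> C"
          then show "m (r *\<^sub>R u) / r \<le> s u"
            using upper [of s "r *\<^sub>R u"] props(2) [of s r u] r by (simp add: field_simps)
        qed
        moreover have "r * m u \<le> m (r *\<^sub>R u)"
        proof (rule great)
          fix s assume "s \<in> C"
          then show "r * m u \<le> s (r *\<^sub>R u)"
            using upper [of s u] props(2) [of s r u] r by simp
        qed
        ultimately show ?thesis using r by (simp add: field_simps)
      qed
      moreover have "m x \<le> s0 x" for x
        using False upper props(3) by (metis all_not_in_conv order_trans)
      ultimately have "m \<in> A" by (auto simp: A_def sublinear_def)
      with upper show ?thesis by (auto simp: le_fun_def)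
    qed
  qed
  then obtain s where "s \<in> A" "\<And>t. t \<in> A \<Longrightarrow> t \<le> s \<Longrightarrow> t = s" by auto
  then show thesis
    by (intro that [of s]) (auto simp: A_def le_fun_def intro: order_trans)
qed

text \<open>
  The form of the Hahn-Banach theorem needed here. Flattening the norm along \<open>x0\<close> makes every
  linear functional below it take the value \<open>norm x0\<close> at \<open>x0\<close>. Working with functionals on the
  whole space avoids extending partially defined ones.
\<close>
lemma exists_norming_functional:
  fixes x0 :: "'a::real_normed_vector"
  obtains u :: "'a \<Rightarrow> real" where "linear u" "\<And>x. \<bar>u x\<bar> \<le> norm x" "u x0 = norm x0"
proof -
  have "sublinear (norm :: 'a \<Rightarrow> real)"
    by (auto simp: sublinear_def norm_triangle_ineq)
  then obtain s0 :: "'a \<Rightarrow> real" where s0: "sublinear s0" "\<And>x. s0 x \<le> norm x" "s0 (- x0) \<le> - norm x0"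
    using sublinear_flatten by metis
  obtain u where u: "sublinear u" "\<And>x. u x \<le> s0 x"
    and min: "\<And>s'. sublinear s' \<Longrightarrow> (\<And>x. s' x \<le> u x) \<Longrightarrow> s' = u"
    using exists_minimal_sublinear [OF s0(1)] by metis
  have lin: "linear u" using minimal_sublinear_linear [OF u(1) min] by blast
  have le: "u x \<le> norm x" for x using u(2) s0(2) order_trans by blast
  have "\<bar>u x\<bar> \<le> norm x" for x
    using le [of x] le [of "- x"] linear_neg [OF lin, of x] by simp
  moreover have "norm x0 \<le> u x0"
    using u(2) [of "- x0"] s0(3) linear_neg [OF lin, of x0] by simp
  ultimately show thesis
    using that [OF lin] le [of x0] by (metis antisym)
qed

context banach_space_over
begin

text \<open>
  A real functional \<open>u\<close> becomes \<open>'k\<close>-linear by taking \<open>u x - i * u (i x)\<close> if there is an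
  imaginary unit. The estimate below allows the norm to double, which is harmless
  for separating points.
\<close>
lemma dual_separates_points:
  assumes "\<And>f. f \<in> dual scal \<Longrightarrow> blinfun_apply f x = blinfun_apply f y"
  shows "x = y"
proof -
  define z where "z = x - y"
  obtain u :: "'a \<Rightarrow> real" where u: "linear u" "\<And>x. \<bar>u x\<bar> \<le> norm x" "u z = norm z"
    using exists_norming_functional by metis
  note lin = linear_add [OF u(1)] linear_scale [OF u(1)]
  have "\<exists>f \<in> dual scal. blinfun_apply f z = 0 \<longrightarrow> u z = 0"
    using real_or_complex [where 'a = 'k]
  proof
    assume real: "\<forall>c::'k. \<exists>a. c = a *\<^sub>R 1"
    have bl: "bounded_linear (\<lambda>x. of_real (u x) :: 'k)"
      using u(2) by (intro bounded_linear_intro [where K = 1]) (auto simp: lin scaleR_conv_of_real)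
    have "Blinfun (\<lambda>x. of_real (u x) :: 'k) \<in> dual scal"
      unfolding dual_def mem_Collect_eq bounded_linear_Blinfun_apply [OF bl]
    proof (intro allI)
      fix c :: 'k and x
      from real obtain a where "c = of_real a" by (auto simp: of_real_def)
      then show "of_real (u (scal c x)) = c * of_real (u x)"
        by (simp add: scal_of_real lin)
    qed
    then show ?thesis
      by (intro bexI [of _ "Blinfun (\<lambda>x. of_real (u x))"]) (auto simp: bounded_linear_Blinfun_apply [OF bl])
  next
    assume "\<exists>i. i * i = - 1 \<and>
        (\<forall>x::'k. \<exists>a b. x = a *\<^sub>R 1 + b *\<^sub>R i \<and> norm x = sqrt (a\<^sup>2 + b\<^sup>2))"
    then obtain i :: 'k where i: "i * i = - 1" and coords: "\<And>c. \<exists>a b. c = of_real a + of_real b * i"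
      by (metis of_real_def scaleR_conv_of_real)
    have "norm i * norm i = 1"
      using i by (metis norm_minus_cancel norm_mult norm_one)
    then have norm_i: "norm i = 1"
      by (metis norm_ge_zero real_sqrt_abs2 real_sqrt_one abs_of_nonneg)
    define g where "g x = of_real (u x) - i * of_real (u (scal i x))" for x
    have scal_i_i: "scal i (scal i x) = - x" for x
      by (simp add: i)
    have g_add: "g (x + y) = g x + g y" for x y
      by (simp add: g_def lin scale_right_distrib algebra_simps)
    have g_real: "g (scal (of_real a) x) = of_real a * g x" for a x
    proof -
      have "scal i (scal (of_real a) x) = a *\<^sub>R scal i x"
        by (metis scal_of_real scale_left_commute)
      then show ?thesis
        by (simp add: g_def lin scal_of_real algebra_simps)
    qed
    have g_i: "g (scal i x) = i * g x" for x
    proof -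
      have "i * (i * w) = - w" for w
        by (metis i mult.assoc mult_minus1)
      then show ?thesis
        by (simp only: g_def scal_i_i linear_neg [OF u(1)] right_diff_distrib) simp
    qed
    have g_scal: "g (scal c x) = c * g x" for c x
    proof -
      obtain a b where c: "c = of_real a + of_real b * i" using coords by blast
      have "scal c x = scal (of_real a) x + scal (of_real b) (scal i x)"
        by (simp add: c scale_left_distrib)
      then show ?thesis
        by (simp only: g_add g_real g_i) (simp add: c algebra_simps)
    qed
    have g_bound: "norm (g x) \<le> 2 * norm x" for x
    proof -
      have "norm (g x) \<le> \<bar>u x\<bar> + \<bar>u (scal i x)\<bar>"
        unfolding g_def by (rule order_trans [OF norm_triangle_ineq4]) (simp add: norm_mult norm_i)
      also have "\<dots> \<le> 2 * norm x"
        using u(2) [of x] u(2) [of "scal i x"] by (simp add: norm_scal norm_i)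
      finally show ?thesis .
    qed
    have bl: "bounded_linear g"
    proof (rule bounded_linear_intro)
      show "g (r *\<^sub>R x) = r *\<^sub>R g x" for r x
        using g_real [of r x] by (simp add: scal_of_real scaleR_conv_of_real)
      show "norm (g x) \<le> norm x * 2" for x
        using g_bound [of x] by simp
    qed (rule g_add)
    have "u z = 0" if "g z = 0"
    proof -
      have eq: "of_real (u z) = i * of_real (u (scal i z))"
        using that by (simp add: g_def)
      have "of_real (u z * u z) = (i * i) * of_real (u (scal i z) * u (scal i z))"
        by (simp add: eq algebra_simps)
      also have "\<dots> = of_real (- (u (scal i z) * u (scal i z)))"
        by (simp add: i)
      finally have "u z * u z = - (u (scal i z) * u (scal i z))"
        by (simp only: of_real_eq_iff)
      then have "u z * u z \<le> 0" by simp
      then show ?thesis by (metis mult_eq_0_iff not_real_square_gt_zero not_less)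
    qed
    with g_scal show ?thesis
      by (intro bexI [of _ "Blinfun g"]) (auto simp: dual_def bounded_linear_Blinfun_apply [OF bl])
  qed
  then have "u z = 0"
    using assms by (auto simp: z_def blinfun.bilinear_simps)
  with u(3) have "norm z = 0" by simp
  then show ?thesis by (simp add: z_def)
qed

end

section \<open>Commutation for exponents below 2\<close>

lemma powr_midpoint_convex:
  fixes a b r :: real
  assumes "1 \<le> r" "0 \<le> a" "0 \<le> b"
  shows "2 * ((a + b) / 2) powr r \<le> a powr r + b powr r"
proof -
  have half: "2 * (c / 2) powr r \<le> c powr r" if "0 \<le> c" for c :: real
  proof -
    have "(2 :: real) powr 1 \<le> 2 powr r" using assms(1) by (intro powr_mono) auto
    then have "2 * c powr r \<le> 2 powr r * c powr r" by (intro mult_right_mono) auto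
    then show ?thesis using that by (simp add: powr_divide field_simps)
  qed
  show ?thesis
  proof (cases "a = 0 \<or> b = 0")
    case True
    then show ?thesis using half [of a] half [of b] assms by auto
  next
    case False
    then show ?thesis
      using convex_onD [OF powr_convex [OF assms(1)], of "1 / 2" a b] assms
      by (simp add: add_divide_distrib)
  qed
qed

text \<open>
  The second difference of \<open>u powr r\<close> at 1 has order \<open>h\<^sup>2\<close>. The weighted geometric mean
  \<open>u powr r = u powr (2 - r) * (u\<^sup>2) powr (r - 1)\<close> is at most the arithmetic one, whose second
  difference is explicit.
\<close>
lemma powr_second_difference:
  fixes h r :: real
  assumes "1 \<le> r" "r \<le> 2" "0 \<le> h" "h < 1"
  shows "(1 + h) powr r + (1 - h) powr r \<le> 2 + 2 * h\<^sup>2"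
proof -
  have young: "u powr r \<le> (2 - r) * u + (r - 1) * u\<^sup>2" if "0 < u" for u :: real
  proof -
    have "u powr (2 - r) * (u powr 2) powr (r - 1) \<le> (2 - r) * u + (r - 1) * u powr 2"
      using assms that by (intro Youngs_inequality_0) auto
    moreover have "u powr (2 - r) * (u powr 2) powr (r - 1) = u powr r"
      by (simp add: powr_powr algebra_simps flip: powr_add)
    ultimately show ?thesis using that by simp
  qed
  have "(1 + h) powr r + (1 - h) powr r \<le> 2 + 2 * (r - 1) * h\<^sup>2"
    using young [of "1 + h"] young [of "1 - h"] assms by (simp add: power2_eq_square algebra_simps)
  also have "\<dots> \<le> 2 + 2 * h\<^sup>2"
    using assms by (intro add_left_mono mult_right_mono) auto
  finally show ?thesis .
qed

text \<open>
  Commutation is proved for real-linear maps on a real subspace \<open>V\<close>, so that it applies both to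
  the space (\<open>V = UNIV\<close>) and to its dual (\<open>V = dual scal\<close>).
\<close>
definition real_linear_on :: "'v::real_vector set \<Rightarrow> ('v \<Rightarrow> 'v) \<Rightarrow> bool"
  where "real_linear_on V T \<longleftrightarrow> T \<in> V \<rightarrow> V \<and>
    (\<forall>x\<in>V. \<forall>y\<in>V. T (x + y) = T x + T y) \<and> (\<forall>r. \<forall>x\<in>V. T (r *\<^sub>R x) = r *\<^sub>R T x)"

lemma real_linear_on_simps:
  assumes "real_linear_on V T" "subspace V"
  shows "x \<in> V \<Longrightarrow> T x \<in> V"
    and "x \<in> V \<Longrightarrow> y \<in> V \<Longrightarrow> T (x + y) = T x + T y"
    and "x \<in> V \<Longrightarrow> T (r *\<^sub>R x) = r *\<^sub>R T x"
    and "x \<in> V \<Longrightarrow> y \<in> V \<Longrightarrow> T (x - y) = T x - T y"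
proof -
  show "x \<in> V \<Longrightarrow> T x \<in> V"
    and 2: "\<And>x y. x \<in> V \<Longrightarrow> y \<in> V \<Longrightarrow> T (x + y) = T x + T y"
    and 3: "\<And>r x. x \<in> V \<Longrightarrow> T (r *\<^sub>R x) = r *\<^sub>R T x" for x
    using assms(1) by (auto simp: real_linear_on_def)
  show "x \<in> V \<Longrightarrow> y \<in> V \<Longrightarrow> T (x - y) = T x - T y"
    using 2 [of x "(-1) *\<^sub>R y"] 3 [of y "-1"] subspace_scale [OF assms(2), of y "-1"] by simp
qed

definition real_Lp_projection :: "ereal \<Rightarrow> 'v::real_normed_vector set \<Rightarrow> ('v \<Rightarrow> 'v) \<Rightarrow> bool"
  where "real_Lp_projection p V P \<longleftrightarrow> real_linear_on V P \<and> (\<forall>x\<in>V. P (P x) = P x) \<and>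
    (\<forall>x\<in>V. norm x = lp_sum p (norm (P x)) (norm (x - P x)))"

lemma real_Lp_projection_complement:
  assumes P: "real_Lp_projection p V P" and V: "subspace V"
  shows "real_Lp_projection p V (\<lambda>x. x - P x)"
proof -
  from P have lin: "real_linear_on V P" by (simp add: real_Lp_projection_def)
  note simps = real_linear_on_simps [OF lin V]
  have "real_linear_on V (\<lambda>x. x - P x)"
    using V by (auto simp: real_linear_on_def simps subspace_diff algebra_simps)
  moreover have "x - P x - P (x - P x) = x - P x" if "x \<in> V" for x
    using P that by (simp add: real_Lp_projection_def simps)
  moreover have "norm x = lp_sum p (norm (x - P x)) (norm (x - (x - P x)))" if "x \<in> V" for x
  proof -
    have "norm x = lp_sum p (norm (P x)) (norm (x - P x))"
      using P that by (simp only: real_Lp_projection_def)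
    also have "\<dots> = lp_sum p (norm (x - P x)) (norm (x - (x - P x)))"
      by (subst lp_sum_commute) simp
    finally show ?thesis .
  qed
  ultimately show ?thesis
    unfolding real_Lp_projection_def by blast
qed

text \<open>
  The reason why commutation holds for \<open>p < 2\<close>. Write \<open>A = norm (P x) ^ p\<close> and
  \<open>B = norm (P x - Q (P x)) ^ p\<close>. Computing the norm of \<open>x + t *\<^sub>R P x\<close> once with \<open>P\<close> and once
  with \<open>Q\<close> shows that, up to an additive constant, \<open>norm (x + t *\<^sub>R Q (P x)) ^ p\<close> equals
  \<open>\<bar>1 + t\<bar> ^ p * A - \<bar>t\<bar> ^ p * B\<close>. This function is convex in \<open>t\<close>. Near \<open>t = 0\<close> the first term bends
  up only by \<open>O(t\<^sup>2)\<close>, which for \<open>p < 2\<close> cannot compensate the term \<open>- \<bar>t\<bar> ^ p * B\<close> unless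
  \<open>B = 0\<close>.
\<close>
lemma Lp_projection_preserves_range:
  assumes V: "subspace V" and P: "real_Lp_projection p V P" and Q: "real_Lp_projection p V Q"
    and p: "1 \<le> p" "p < 2" and x: "x \<in> V" "Q x = x"
  shows "Q (P x) = P x"
proof -
  from p obtain r where r: "p = ereal r" "1 \<le> r"
    by (auto elim!: lp_sum_cases)
  with p have r2: "r < 2" by simp
  have P_lin: "real_linear_on V P" and Q_lin: "real_linear_on V Q"
    using P Q by (auto simp: real_Lp_projection_def)
  note simps = real_linear_on_simps [OF P_lin V] real_linear_on_simps [OF Q_lin V]
  have PP: "P (P z) = P z" and QQ: "Q (Q z) = Q z" if "z \<in> V" for z
    using P Q that by (auto simp: real_Lp_projection_def)
  have normP: "norm z powr r = norm (P z) powr r + norm (z - P z) powr r" if "z \<in> V" for z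
    using P that r by (auto simp: real_Lp_projection_def lp_sum_powr)
  have normQ: "norm z powr r = norm (Q z) powr r + norm (z - Q z) powr r" if "z \<in> V" for z
    using Q that r by (auto simp: real_Lp_projection_def lp_sum_powr)
  define A B where "A = norm (P x) powr r" and "B = norm (P x - Q (P x)) powr r"
  have bound: "B * h powr r \<le> A * h\<^sup>2" if h: "0 < h" "h < 1" for h
  proof -
    have perturbed: "norm (x + t *\<^sub>R Q (P x)) powr r + \<bar>t\<bar> powr r * B
        = \<bar>1 + t\<bar> powr r * A + norm (x - P x) powr r" for t
    proof -
      have Px: "P x \<in> V" "t *\<^sub>R P x \<in> V" and z: "x + t *\<^sub>R P x \<in> V"
        using x V by (auto simp: simps subspace_add subspace_scale)
      have "P (x + t *\<^sub>R P x) = (1 + t) *\<^sub>R P x"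
        using x Px by (simp add: simps PP algebra_simps)
      then have "norm (x + t *\<^sub>R P x) powr r = norm ((1 + t) *\<^sub>R P x) powr r + norm (x - P x) powr r"
        using normP [OF z] by (simp add: algebra_simps)
      moreover have "Q (x + t *\<^sub>R P x) = x + t *\<^sub>R Q (P x)"
        using x Px by (simp add: simps)
      then have "norm (x + t *\<^sub>R P x) powr r
          = norm (x + t *\<^sub>R Q (P x)) powr r + norm (t *\<^sub>R (P x - Q (P x))) powr r"
        using normQ [OF z] by (simp add: algebra_simps)
      ultimately show ?thesis
        by (simp add: A_def B_def powr_mult)
    qed
    have "norm x \<le> (norm (x + h *\<^sub>R Q (P x)) + norm (x + (- h) *\<^sub>R Q (P x))) / 2"
      using norm_triangle_ineq [of "x + h *\<^sub>R Q (P x)" "x + (- h) *\<^sub>R Q (P x)"]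
      by (simp flip: scaleR_2)
    then have "2 * norm x powr r
        \<le> 2 * ((norm (x + h *\<^sub>R Q (P x)) + norm (x + (- h) *\<^sub>R Q (P x))) / 2) powr r"
      using r by (intro mult_left_mono powr_mono2) auto
    also have "\<dots> \<le> norm (x + h *\<^sub>R Q (P x)) powr r + norm (x + (- h) *\<^sub>R Q (P x)) powr r"
      using r by (intro powr_midpoint_convex) auto
    also have "\<dots> = A * ((1 + h) powr r + (1 - h) powr r) + 2 * norm (x - P x) powr r
        - 2 * h powr r * B"
      using perturbed [of h] perturbed [of "- h"] h by (simp add: algebra_simps)
    also have "\<dots> \<le> A * (2 + 2 * h\<^sup>2) + 2 * norm (x - P x) powr r - 2 * h powr r * B"
      using r r2 h by (intro diff_right_mono add_right_mono mult_left_mono powr_second_difference)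
        (auto simp: A_def)
    finally show ?thesis
      using normP [OF x(1)] by (simp add: A_def algebra_simps)
  qed
  have "B = 0"
  proof (rule ccontr)
    assume "B \<noteq> 0"
    then have B: "0 < B" by (simp add: B_def)
    have A: "0 \<le> A" by (simp add: A_def)
    \<comment> \<open>Choose h so small that A h^2 = A k h^r < B h^r.\<close>
    define k where "k = B / (A + 2 * B)"
    have k: "0 < k" "k < 1" "A * k < B"
      using A B by (auto simp: k_def field_simps add_strict_increasing)
    define h where "h = k powr (1 / (2 - r))"
    have h: "0 < h" "h < 1" "h powr (2 - r) = k"
      using k r2 powr_less_mono2 [of "1 / (2 - r)" k 1] by (auto simp: h_def powr_powr)
    have "h powr r * k = h\<^sup>2"
      using h(1) by (simp flip: h(3) powr_add)
    then have "B * h powr r \<le> (A * k) * h powr r"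
      using bound [OF h(1,2)] by (simp add: mult_ac)
    with k(3) h(1) show False by (simp add: mult_le_cancel_right)
  qed
  then show ?thesis by (simp add: B_def)
qed

text \<open>
  \<open>P\<close> maps the range of \<open>Q\<close> into itself and, since \<open>1 - Q\<close> is an \<open>L\<^sup>p\<close>-projection as well, also
  the kernel of \<open>Q\<close>; together this says that \<open>P\<close> and \<open>Q\<close> commute.
\<close>
lemma Lp_projections_commute_below_2:
  assumes V: "subspace V" and P: "real_Lp_projection p V P" and Q: "real_Lp_projection p V Q"
    and p: "1 \<le> p" "p < 2" and x: "x \<in> V"
  shows "P (Q x) = Q (P x)"
proof -
  have P_lin: "real_linear_on V P" and Q_lin: "real_linear_on V Q"
    using P Q by (auto simp: real_Lp_projection_def)
  note simps = real_linear_on_simps [OF P_lin V] real_linear_on_simps [OF Q_lin V]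
  have QQ: "Q (Q x) = Q x" using Q x by (auto simp: real_Lp_projection_def)
  have "Q (P (Q x)) = P (Q x)"
    using Lp_projection_preserves_range [OF V P Q p] x QQ by (simp add: simps)
  moreover have "P (x - Q x) - Q (P (x - Q x)) = P (x - Q x)"
    using Lp_projection_preserves_range [OF V P real_Lp_projection_complement [OF Q V] p, of "x - Q x"]
      V x QQ by (simp add: simps subspace_diff)
  then have "Q (P x) = Q (P (Q x))"
    using x V by (simp add: simps subspace_diff)
  ultimately show ?thesis by simp
qed

section \<open>Adjoint projections and commutation by duality\<close>

lemma bounded_operators_apply:
  assumes "T \<in> bounded_operators scal V"
  shows "x \<in> V \<Longrightarrow> T x \<in> V"
    and "x \<in> V \<Longrightarrow> y \<in> V \<Longrightarrow> T (x + y) = T x + T y"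
    and "x \<in> V \<Longrightarrow> T (scal c x) = scal c (T x)"
    and "T \<in> extensional V"
  using assms by (auto simp: bounded_operators_def PiE_iff)

lemma compose_eq_iff:
  assumes "R \<in> extensional V"
  shows "compose V S T = R \<longleftrightarrow> (\<forall>x\<in>V. S (T x) = R x)"
  using assms by (auto simp: compose_def extensional_def fun_eq_iff)

lemma Lp_projections_iff:
  assumes "1 \<le> p"
  shows "P \<in> Lp_projections p scal V \<longleftrightarrow> P \<in> bounded_operators scal V \<and>
    (\<forall>x\<in>V. P (P x) = P x) \<and> (\<forall>x\<in>V. norm x = lp_sum p (norm (P x)) (norm (x - P x)))"
proof -
  have "(if p = \<infinity> then norm x = max (norm (P x)) (norm (x - P x))
      else norm x powr real_of_ereal p
        = norm (P x) powr real_of_ereal p + norm (x - P x) powr real_of_ereal p)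
    \<longleftrightarrow> norm x = lp_sum p (norm (P x)) (norm (x - P x))" for x
    using assms by (auto elim!: lp_sum_cases simp: lp_sum_infinity lp_sum_eq_iff)
  then show ?thesis
    by (auto simp: Lp_projections_def compose_eq_iff bounded_operators_apply)
qed

lemma Lp_projectionsD:
  assumes "1 \<le> p" "P \<in> Lp_projections p scal V"
  shows "P \<in> bounded_operators scal V"
    and "x \<in> V \<Longrightarrow> P (P x) = P x"
    and "x \<in> V \<Longrightarrow> norm x = lp_sum p (norm (P x)) (norm (x - P x))"
  using assms(2) unfolding Lp_projections_iff [OF assms(1)] by blast+

lemma subspace_dual: "subspace (dual scal)"
proof -
  have "r *\<^sub>R f \<in> dual scal" if "f \<in> dual scal" for r f
    using that by (auto simp: dual_def blinfun.bilinear_simps)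
  moreover have "0 \<in> dual scal" by (simp add: dual_def)
  ultimately show ?thesis using dual_closed(2) by (auto simp: subspace_def)
qed

lemma dual_scal_of_real: "dual_scal (of_real r) f = r *\<^sub>R f"
  by (intro blinfun_eqI) (simp add: blinfun.bilinear_simps scaleR_conv_of_real)

lemma Lp_projection_imp_real:
  assumes "1 \<le> p" "P \<in> Lp_projections p scal V"
    and scal: "\<And>r x. x \<in> V \<Longrightarrow> scal (of_real r) x = r *\<^sub>R x"
  shows "real_Lp_projection p V P"
proof -
  note P = Lp_projectionsD(1) [OF assms(1,2)]
  have "P (r *\<^sub>R x) = r *\<^sub>R P x" if "x \<in> V" for r x
    using bounded_operators_apply(1,3) [OF P that] scal that by metis
  then have "real_linear_on V P"
    using bounded_operators_apply(1,2) [OF P] by (auto simp: real_linear_on_def)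
  then show ?thesis
    using Lp_projectionsD(2,3) [OF assms(1,2)] unfolding real_Lp_projection_def by blast
qed

text \<open>
  Two independent suprema, over \<open>x\<close> and over \<open>y\<close>, in a form that is homogeneous in both
  variables. The bounds on \<open>g\<close> and on \<open>h\<close> alone cover the trivial space, where \<open>joint\<close> carries
  no information.
\<close>
lemma norm_blinfun_sum_bound:
  fixes g h :: "'a::real_normed_vector \<Rightarrow>\<^sub>L 'k::real_normed_vector"
  assumes nonneg: "0 \<le> \<alpha>" "0 \<le> \<beta>"
    and g: "\<alpha> * norm g \<le> M" and h: "\<beta> * norm h \<le> M"
    and joint: "\<And>x y. \<alpha> * norm (g x) * norm y + \<beta> * norm (h y) * norm x \<le> M * norm x * norm y"
  shows "\<alpha> * norm g + \<beta> * norm h \<le> M"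
proof -
  have "norm (\<beta> *\<^sub>R h) \<le> M - \<alpha> * norm g"
  proof (rule norm_blinfun_bound)
    fix y
    have "\<beta> * norm (h y) \<le> (\<beta> * norm h) * norm y"
      using nonneg norm_blinfun [of h y] by (simp add: mult.assoc mult_left_mono)
    also have "\<dots> \<le> M * norm y" using h by (intro mult_right_mono) auto
    finally have *: "\<beta> * norm (h y) \<le> M * norm y" .
    \<comment> \<open>For fixed y this is the supremum over x.\<close>
    have "norm ((\<alpha> * norm y) *\<^sub>R g) \<le> M * norm y - \<beta> * norm (h y)"
      using * joint [of _ y] nonneg
      by (intro norm_blinfun_bound) (auto simp: blinfun.bilinear_simps algebra_simps)
    then show "norm ((\<beta> *\<^sub>R h) y) \<le> (M - \<alpha> * norm g) * norm y"
      using nonneg by (simp add: blinfun.bilinear_simps algebra_simps)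
  qed (use g in simp)
  then show ?thesis using nonneg by simp
qed

lemma exists_unit_multiplier:
  fixes z :: "'k::real_normed_field"
  obtains c where "norm c = 1" "c * z = of_real (norm z)"
proof (cases "z = 0")
  case True
  then show thesis by (intro that [of 1]) auto
next
  case False
  then show thesis by (intro that [of "of_real (norm z) / z"]) (auto simp: norm_divide)
qed

context banach_space_over
begin

text \<open>
  Hoelder's inequality applied to \<open>f x = f (P x) + f (x - P x)\<close>.
\<close>
lemma Lp_projection_norm_dual_le:
  assumes pq: "1 \<le> p" "1 \<le> q" "1 / p + 1 / q = 1"
    and P: "P \<in> Lp_projections p scal UNIV" and f: "f \<in> dual scal"
    and g: "\<And>x. blinfun_apply g x = blinfun_apply f (P x)"
  shows "norm f \<le> lp_sum q (norm g) (norm (f - g))"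
proof (rule norm_blinfun_bound)
  note bdd = Lp_projectionsD(1) [OF pq(1) P]
  note PP = Lp_projectionsD(2) [OF pq(1) P UNIV_I] and normP = Lp_projectionsD(3) [OF pq(1) P UNIV_I]
  fix x
  have diff: "P (x - P x) = 0"
    using bounded_linear_bounded_operator [OF bdd] by (simp add: linear_diff bounded_linear.linear PP)
  have "blinfun_apply f x = blinfun_apply g (P x) + blinfun_apply (f - g) (x - P x)"
    by (simp add: g blinfun.diff_left PP diff flip: blinfun.add_right)
  also have "norm \<dots> \<le> norm (P x) * norm g + norm (x - P x) * norm (f - g)"
    by (intro norm_triangle_le add_mono order_trans [OF norm_blinfun]) (auto simp: mult.commute)
  also have "\<dots> \<le> norm x * lp_sum q (norm g) (norm (f - g))"
    using lp_sum_Hoelder [OF pq, of "norm (P x)" "norm (x - P x)" "norm g" "norm (f - g)"] normP [of x]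
    by simp
  finally show "norm (blinfun_apply f x) \<le> lp_sum q (norm g) (norm (f - g)) * norm x"
    by (simp add: mult.commute)
qed (simp add: lp_sum_nonneg)

text \<open>
  Let \<open>(\<alpha>, \<beta>)\<close> in the l^p unit ball be extremal for \<open>(norm g, norm (f - g))\<close>. If \<open>x\<close> and \<open>y\<close> are unit
  vectors at which \<open>g\<close> and \<open>f - g\<close> are almost norming, then a combination of \<open>P x\<close> and \<open>y - P y\<close>
  with coefficients of modulus \<open>\<alpha>\<close> and \<open>\<beta>\<close> has norm at most 1, and \<open>f\<close> takes on it a value close
  to \<open>lp_sum q (norm g) (norm (f - g))\<close>. The factors \<open>norm y\<close> and \<open>norm x\<close> in the vectors \<open>v\<close> and
  \<open>w\<close> make the argument homogeneous, so that no normalisation is necessary.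
\<close>
lemma Lp_projection_norm_dual_ge:
  assumes pq: "1 \<le> p" "1 \<le> q" "1 / p + 1 / q = 1"
    and P: "P \<in> Lp_projections p scal UNIV" and f: "f \<in> dual scal"
    and g: "\<And>x. blinfun_apply g x = blinfun_apply f (P x)"
  shows "lp_sum q (norm g) (norm (f - g)) \<le> norm f"
proof -
  note bdd = Lp_projectionsD(1) [OF pq(1) P]
  note PP = Lp_projectionsD(2) [OF pq(1) P UNIV_I] and normP = Lp_projectionsD(3) [OF pq(1) P UNIV_I]
  have lin: "linear P" and sc: "P (scal c x) = scal c (P x)" for c x
    using bounded_linear_bounded_operator [OF bdd] bounded_operators_apply(3) [OF bdd]
    by (auto simp: bounded_linear.linear)
  have contr: "norm (P x) \<le> norm x" "norm (x - P x) \<le> norm x" for x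
    using lp_sum_ge [OF pq(1), of "norm (P x)" "norm (x - P x)"] normP [of x] by auto
  have h: "blinfun_apply (f - g) x = blinfun_apply f (x - P x)" for x
    by (simp add: g blinfun.bilinear_simps)
  have le_f: "norm (blinfun_apply f x) \<le> norm f * r" if "norm x \<le> r" for x r
    using that by (intro order_trans [OF norm_blinfun] mult_left_mono) auto
  have norm_g: "norm g \<le> norm f" and norm_h: "norm (f - g) \<le> norm f"
    by (intro norm_blinfun_bound; simp add: g h le_f contr)+
  obtain \<alpha> \<beta> where ab: "0 \<le> \<alpha>" "0 \<le> \<beta>" "lp_sum p \<alpha> \<beta> \<le> 1"
    "\<alpha> * norm g + \<beta> * norm (f - g) = lp_sum q (norm g) (norm (f - g))"
    by (rule lp_sum_Hoelder_attained [OF pq, of "norm g" "norm (f - g)"]) auto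
  have le1: "\<alpha> \<le> 1" "\<beta> \<le> 1"
    using lp_sum_ge [OF pq(1) ab(1,2)] ab(3) by auto
  have "\<alpha> * norm g + \<beta> * norm (f - g) \<le> norm f"
  proof (rule norm_blinfun_sum_bound [OF ab(1,2)])
    show "\<alpha> * norm g \<le> norm f"
      using mult_mono [OF le1(1) norm_g] by simp
    show "\<beta> * norm (f - g) \<le> norm f"
      using mult_mono [OF le1(2) norm_h] by simp
  next
    fix x y
    obtain c where c: "norm c = 1" "c * blinfun_apply f (P x) = of_real (norm (blinfun_apply f (P x)))"
      by (rule exists_unit_multiplier)
    obtain d where d: "norm d = 1"
      "d * blinfun_apply f (y - P y) = of_real (norm (blinfun_apply f (y - P y)))"
      by (rule exists_unit_multiplier)
    define v where "v = scal (of_real (\<alpha> * norm y) * c) (P x)"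
    define w where "w = scal (of_real (\<beta> * norm x) * d) (y - P y)"
    have vw: "P v = v" "P w = 0"
      by (simp_all add: v_def w_def sc PP linear_diff [OF lin])
    have "norm (v + w) = lp_sum p (norm v) (norm w)"
      using normP [of "v + w"] by (simp add: linear_add [OF lin] vw)
    also have "\<dots> \<le> lp_sum p ((norm x * norm y) * \<alpha>) ((norm x * norm y) * \<beta>)"
    proof (rule lp_sum_mono [OF pq(1)])
      have "\<alpha> * norm y * norm (P x) \<le> \<alpha> * norm y * norm x"
        using ab contr by (intro mult_left_mono) auto
      then show "norm v \<le> norm x * norm y * \<alpha>"
        using ab by (simp add: v_def norm_scal norm_mult c mult_ac)
      have "\<beta> * norm x * norm (y - P y) \<le> \<beta> * norm x * norm y"
        using ab contr by (intro mult_left_mono) auto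
      then show "norm w \<le> norm x * norm y * \<beta>"
        using ab by (simp add: w_def norm_scal norm_mult d mult_ac)
    qed auto
    also have "\<dots> = norm x * norm y * lp_sum p \<alpha> \<beta>"
      using ab by (intro lp_sum_mult pq) auto
    also have "\<dots> \<le> norm x * norm y"
      using ab by (intro mult_left_le) auto
    finally have bound: "norm (v + w) \<le> norm x * norm y" .
    have fsc: "blinfun_apply f (scal k u) = k * blinfun_apply f u" for k u
      using f by (simp add: dual_def)
    have "blinfun_apply f (v + w)
        = of_real (\<alpha> * norm y * norm (blinfun_apply f (P x)) + \<beta> * norm x * norm (blinfun_apply f (y - P y)))"
      unfolding blinfun.add_right v_def w_def fsc mult.assoc c d by simp
    then have "\<alpha> * norm y * norm (blinfun_apply f (P x)) + \<beta> * norm x * norm (blinfun_apply f (y - P y))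
        = norm (blinfun_apply f (v + w))"
      using ab by (simp only: norm_of_real) simp
    also have "\<dots> \<le> norm f * (norm x * norm y)"
      using bound by (rule le_f)
    finally show "\<alpha> * norm (blinfun_apply g x) * norm y + \<beta> * norm (blinfun_apply (f - g) y) * norm x
        \<le> norm f * norm x * norm y"
      by (simp add: g h mult_ac)
  qed
  with ab(4) show ?thesis by simp
qed

lemma adjoint_Lp_projection:
  assumes pq: "1 \<le> p" "1 \<le> q" "1 / p + 1 / q = 1"
    and P: "P \<in> Lp_projections p scal UNIV"
  shows "adjoint_operator scal P \<in> Lp_projections q dual_scal (dual scal)"
proof -
  note bdd = Lp_projectionsD(1) [OF pq(1) P] and PP = Lp_projectionsD(2) [OF pq(1) P UNIV_I]
  note app = adjoint_operator_apply [OF bdd]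
  note adj = adjoint_operator_bounded [OF bdd]
  have "adjoint_operator scal P (adjoint_operator scal P f) = adjoint_operator scal P f"
    if "f \<in> dual scal" for f
    using that by (intro blinfun_eqI) (simp add: app bounded_operators_apply(1) [OF adj] PP)
  moreover have "norm f
      = lp_sum q (norm (adjoint_operator scal P f)) (norm (f - adjoint_operator scal P f))"
    if "f \<in> dual scal" for f
    using Lp_projection_norm_dual_le [OF pq P that] Lp_projection_norm_dual_ge [OF pq P that] app [OF that]
    by (intro antisym) auto
  ultimately show ?thesis
    using adj unfolding Lp_projections_iff [OF pq(2)] by blast
qed

lemma bounded_operators_compose:
  assumes S: "S \<in> bounded_operators scal UNIV" and T: "T \<in> bounded_operators scal UNIV"
  shows "(\<lambda>x. S (T x)) \<in> bounded_operators scal UNIV"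
proof -
  obtain K where "\<And>x. norm (S (T x)) \<le> norm x * K"
    using bounded_linear.bounded [OF bounded_linear_compose [OF bounded_linear_bounded_operator [OF S]
      bounded_linear_bounded_operator [OF T]]] by auto
  then have "\<exists>K. \<forall>x. norm (S (T x)) \<le> K * norm x" by (metis mult.commute)
  then show ?thesis
    using S T by (auto simp: bounded_operators_def)
qed

lemma adjoint_compose:
  assumes S: "S \<in> bounded_operators scal UNIV" and T: "T \<in> bounded_operators scal UNIV"
  shows "adjoint_operator scal (\<lambda>x. S (T x))
    = compose (dual scal) (adjoint_operator scal T) (adjoint_operator scal S)"
proof
  fix f
  show "adjoint_operator scal (\<lambda>x. S (T x)) f
    = compose (dual scal) (adjoint_operator scal T) (adjoint_operator scal S) f"
  proof (cases "f \<in> dual scal")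
    case True
    note closed = bounded_operators_apply(1) [OF adjoint_operator_bounded [OF S] True]
    show ?thesis
      using True closed
      by (intro blinfun_eqI)
        (simp add: compose_def adjoint_operator_apply S T bounded_operators_compose)
  qed (simp add: adjoint_operator_def compose_def)
qed

lemma adjoint_inject:
  assumes S: "S \<in> bounded_operators scal UNIV" and T: "T \<in> bounded_operators scal UNIV"
    and eq: "adjoint_operator scal S = adjoint_operator scal T"
  shows "S = T"
proof
  fix x
  show "S x = T x"
    using adjoint_operator_apply [OF S, of _ x] adjoint_operator_apply [OF T, of _ x] eq
    by (intro dual_separates_points) metis
qed

lemma exists_conjugate_exponent_above_2:
  fixes p :: ereal
  assumes "2 < p"
  obtains q :: ereal where "1 \<le> q" "q < 2" "1 / p + 1 / q = 1"
proof (cases p)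
  case (real r)
  with assms have r: "2 < r" by simp
  have "1 / p + 1 / ereal (r / (r - 1)) = 1"
    using r real by (simp add: one_ereal_def field_simps)
  moreover have "1 \<le> ereal (r / (r - 1))" "ereal (r / (r - 1)) < 2"
    using r by (auto simp: one_ereal_def field_simps)
  ultimately show thesis using that by blast
next
  case PInf
  then show thesis by (intro that [of 1]) (auto simp: one_ereal_def)
qed (use assms in simp)

text \<open>
  For \<open>p > 2\<close>, including \<open>p = \<infinity>\<close>, the conjugate exponent is below 2. The adjoints are
  \<open>L\<^sup>q\<close>-projections on the dual space and commute there; as operators are determined by their
  adjoints, the projections commute themselves.
\<close>
theorem Lp_projections_commute:
  assumes p: "1 \<le> p" "p \<noteq> 2"
    and P: "P \<in> Lp_projections p scal UNIV" and Q: "Q \<in> Lp_projections p scal UNIV"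
  shows "P (Q x) = Q (P x)"
proof (cases "p < 2")
  case True
  show ?thesis
    using Lp_projections_commute_below_2 [OF Real_Vector_Spaces.subspace_UNIV _ _ p(1) True, of P Q x]
      Lp_projection_imp_real [OF p(1) P] Lp_projection_imp_real [OF p(1) Q]
    by (simp add: scal_of_real)
next
  case False
  with p have "2 < p" by simp
  then obtain q where q: "1 \<le> q" "q < 2" "1 / p + 1 / q = 1"
    by (rule exists_conjugate_exponent_above_2)
  let ?P = "adjoint_operator scal P" and ?Q = "adjoint_operator scal Q"
  have bdd: "P \<in> bounded_operators scal UNIV" "Q \<in> bounded_operators scal UNIV"
    using P Q p by (auto intro: Lp_projectionsD)
  have "real_Lp_projection q (dual scal) ?P" "real_Lp_projection q (dual scal) ?Q"
    using adjoint_Lp_projection [OF p(1) q(1,3)] P Q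
    by (blast intro: Lp_projection_imp_real [OF q(1)] dual_scal_of_real)+
  then have "?P (?Q f) = ?Q (?P f)" if "f \<in> dual scal" for f
    using Lp_projections_commute_below_2 [OF subspace_dual _ _ q(1,2) that] by blast
  then have "compose (dual scal) ?Q ?P = compose (dual scal) ?P ?Q"
    by (auto simp: compose_def)
  then have "adjoint_operator scal (\<lambda>x. P (Q x)) = adjoint_operator scal (\<lambda>x. Q (P x))"
    by (simp only: adjoint_compose bdd)
  then have "(\<lambda>x. P (Q x)) = (\<lambda>x. Q (P x))"
    by (rule adjoint_inject [OF bounded_operators_compose [OF bdd(1,2)]
      bounded_operators_compose [OF bdd(2,1)]])
  then show ?thesis by metis
qed

end

section \<open>The inverse semigroup of partial isometries\<close>

lemma compose_UNIV: "compose UNIV f g = (\<lambda>x. f (g x))"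
  by (auto simp: compose_def)

text \<open>
  \<open>S\<close> is a contractive generalized inverse that witnesses \<open>T \<in> Lp_PIso\<close>. The symmetry between
  \<open>T\<close> and \<open>S\<close> is visible in this relation.
\<close>
definition Lp_inverses ::
    "ereal \<Rightarrow> ('k \<Rightarrow> 'a \<Rightarrow> 'a) \<Rightarrow> ('a::real_normed_vector \<Rightarrow> 'a) \<Rightarrow> ('a \<Rightarrow> 'a) \<Rightarrow> bool"
  where "Lp_inverses p scal T S \<longleftrightarrow>
    T \<in> contractions scal UNIV \<and> S \<in> contractions scal UNIV \<and>
    (\<forall>x. T (S (T x)) = T x) \<and> (\<forall>x. S (T (S x)) = S x) \<and>
    (\<lambda>x. T (S x)) \<in> Lp_projections p scal UNIV \<and> (\<lambda>x. S (T x)) \<in> Lp_projections p scal UNIV"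

lemma Lp_PIso_iff: "T \<in> Lp_PIso p scal UNIV \<longleftrightarrow> (\<exists>S. Lp_inverses p scal T S)"
  by (auto simp: Lp_PIso_def Lp_inverses_def compose_UNIV fun_eq_iff)

lemma Lp_inverses_sym: "Lp_inverses p scal T S \<Longrightarrow> Lp_inverses p scal S T"
  by (auto simp: Lp_inverses_def)

lemma Lp_inverses_imp_PIso:
  assumes "Lp_inverses p scal T S"
  shows "T \<in> Lp_PIso p scal UNIV" "S \<in> Lp_PIso p scal UNIV"
  unfolding Lp_PIso_iff using assms Lp_inverses_sym by blast+

lemma Lp_projection_contraction:
  assumes "1 \<le> p" "P \<in> Lp_projections p scal V"
  shows "P \<in> contractions scal V"
proof -
  have "norm (P x) \<le> norm x" if "x \<in> V" for x
    unfolding Lp_projectionsD(3) [OF assms that]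
    using lp_sum_ge(1) [OF assms(1), of "norm (P x)" "norm (x - P x)"] by simp
  then show ?thesis
    using Lp_projectionsD(1) [OF assms] by (simp add: contractions_def)
qed

lemma Lp_projection_self_inverse:
  assumes "1 \<le> p" "P \<in> Lp_projections p scal UNIV"
  shows "Lp_inverses p scal P P"
  using Lp_projection_contraction [OF assms] Lp_projectionsD(2) [OF assms UNIV_I] assms(2)
  by (simp add: Lp_inverses_def)

lemma (in banach_space_over) identity_Lp_projection:
  assumes "1 \<le> p"
  shows "(\<lambda>x. x) \<in> Lp_projections p scal UNIV"
  using assms
  by (auto simp: Lp_projections_iff bounded_operators_def lp_sum_zero intro: exI [of _ 1])

context banach_space_over
begin

text \<open>
  \<open>T\<close> maps the range of \<open>S T\<close> isometrically onto the range of \<open>T S\<close>, with inverse \<open>S\<close>. As \<open>E\<close>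
  commutes with \<open>S T\<close>, it splits the range of \<open>S T\<close> in the \<open>L\<^sup>p\<close> sense, so \<open>T E S\<close> splits the
  range of \<open>T S\<close>. This splitting is combined with that of the whole space by \<open>T S\<close>, using that
  \<open>lp_sum\<close> is associative.
\<close>
lemma Lp_projection_conjugate:
  assumes p: "1 \<le> p" and TS: "Lp_inverses p scal T S" and E: "E \<in> Lp_projections p scal UNIV"
    and comm: "\<And>x. E (S (T x)) = S (T (E x))"
  shows "(\<lambda>x. T (E (S x))) \<in> Lp_projections p scal UNIV"
proof -
  have bdd: "T \<in> bounded_operators scal UNIV" "S \<in> bounded_operators scal UNIV"
    "E \<in> bounded_operators scal UNIV"
    and contr: "norm (T x) \<le> norm x" "norm (S x) \<le> norm x"
    and TST: "T (S (T x)) = T x" and STS: "S (T (S x)) = S x" for x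
    using TS Lp_projectionsD(1) [OF p E] by (auto simp: Lp_inverses_def contractions_def)
  have TSproj: "(\<lambda>x. T (S x)) \<in> Lp_projections p scal UNIV"
    using TS by (simp add: Lp_inverses_def)
  have linear: "linear T" "linear S" "linear E"
    using bdd bounded_linear_bounded_operator by (auto simp: bounded_linear.linear)
  note EE = Lp_projectionsD(2) [OF p E UNIV_I] and normE = Lp_projectionsD(3) [OF p E UNIV_I]
    and normTS = Lp_projectionsD(3) [OF p TSproj UNIV_I]
  define G where "G x = T (E (S x))" for x
  \<comment> \<open>A contraction with a contractive left inverse at y preserves the norm of y.\<close>
  have isometric: "norm (T y) = norm y" if "S (T y) = y" for y
    using contr(1) [of y] contr(2) [of "T y"] that by simp
  have ES: "S (T (E (S x))) = E (S x)" for x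
    using comm [of "S x"] by (simp add: STS)
  have GG: "G (G x) = G x" for x
    by (simp add: G_def ES EE)
  have TSG: "T (S (G x)) = G x" for x
    by (simp add: G_def TST)
  have "norm x = lp_sum p (norm (G x)) (norm (x - G x))" for x
  proof -
    have range: "norm (S x) = norm (T (S x))" "norm (E (S x)) = norm (G x)"
      using isometric [of "S x"] isometric [of "E (S x)"] by (simp_all add: STS ES G_def)
    have "norm (S x - E (S x)) = norm (T (S x) - G x)"
      using isometric [of "S x - E (S x)"] by (simp add: linear_diff linear STS ES G_def)
    with normE [of "S x"] range
    have inner: "norm (T (S x)) = lp_sum p (norm (G x)) (norm (T (S x) - G x))"
      by simp
    have outer: "norm (x - G x) = lp_sum p (norm (T (S x) - G x)) (norm (x - T (S x)))"
      using normTS [of "x - G x"] by (simp add: linear_diff linear TSG)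
    have "norm x = lp_sum p (lp_sum p (norm (G x)) (norm (T (S x) - G x))) (norm (x - T (S x)))"
      using normTS [of x] by (simp only: flip: inner)
    also have "\<dots> = lp_sum p (norm (G x)) (norm (x - G x))"
      by (simp only: lp_sum_assoc [OF p] outer)
    finally show ?thesis .
  qed
  moreover have "G \<in> bounded_operators scal UNIV"
    unfolding G_def using bounded_operators_compose [OF bdd(1) bounded_operators_compose [OF bdd(3,2)]] .
  ultimately have "G \<in> Lp_projections p scal UNIV"
    unfolding Lp_projections_iff [OF p] using GG by blast
  then show ?thesis by (simp add: G_def [abs_def])
qed

lemma contractions_compose:
  assumes "S \<in> contractions scal UNIV" "T \<in> contractions scal UNIV"
  shows "(\<lambda>x. S (T x)) \<in> contractions scal UNIV"
  using assms bounded_operators_compose by (auto simp: contractions_def intro: order_trans)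

text \<open>
  With \<open>T2 S2\<close> and \<open>S1 T1\<close> commuting, the products \<open>T1 (T2 S2) S1\<close> and \<open>S2 (S1 T1) T2\<close> are
  conjugates of \<open>L\<^sup>p\<close>-projections.
\<close>
lemma Lp_inverses_compose:
  assumes p: "1 \<le> p" "p \<noteq> 2"
    and 1: "Lp_inverses p scal T1 S1" and 2: "Lp_inverses p scal T2 S2"
  shows "Lp_inverses p scal (\<lambda>x. T1 (T2 x)) (\<lambda>x. S2 (S1 x))"
proof -
  have comm: "T2 (S2 (S1 (T1 x))) = S1 (T1 (T2 (S2 x)))" for x
    using Lp_projections_commute [OF p, of "\<lambda>x. T2 (S2 x)" "\<lambda>x. S1 (T1 x)" x] 1 2
    by (simp add: Lp_inverses_def)
  have "(\<lambda>x. T1 (T2 (S2 (S1 x)))) \<in> Lp_projections p scal UNIV"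
    using Lp_projection_conjugate [OF p(1) 1, of "\<lambda>x. T2 (S2 x)"] 2 comm
    by (simp add: Lp_inverses_def)
  moreover have "(\<lambda>x. S2 (S1 (T1 (T2 x)))) \<in> Lp_projections p scal UNIV"
    using Lp_projection_conjugate [OF p(1) Lp_inverses_sym [OF 2], of "\<lambda>x. S1 (T1 x)"] 1 comm
    by (simp add: Lp_inverses_def)
  moreover have "T1 (T2 (S2 (S1 (T1 (T2 x))))) = T1 (T2 x)" "S2 (S1 (T1 (T2 (S2 (S1 x))))) = S2 (S1 x)" for x
    using 1 2 comm [of "T2 x"] comm [of "S1 x", symmetric] by (simp_all add: Lp_inverses_def)
  ultimately show ?thesis
    using 1 2 contractions_compose by (simp add: Lp_inverses_def)
qed

text \<open>
  Commutation of \<open>T S\<close> and \<open>S T\<close> gives \<open>T S S T = S T T S = S\<close>. Multiplying by \<open>T\<close> on either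
  side leads to \<open>T S = S = S T\<close>, and then \<open>T = T S T = S\<close>.
\<close>
lemma Lp_inverses_idempotent:
  assumes p: "1 \<le> p" "p \<noteq> 2" and TS: "Lp_inverses p scal T S" and TT: "\<And>x. T (T x) = T x"
  shows "T \<in> Lp_projections p scal UNIV"
proof -
  have TST: "T (S (T x)) = T x" and STS: "S (T (S x)) = S x" for x
    using TS by (auto simp: Lp_inverses_def)
  have proj: "(\<lambda>x. T (S x)) \<in> Lp_projections p scal UNIV" "(\<lambda>x. S (T x)) \<in> Lp_projections p scal UNIV"
    using TS by (auto simp: Lp_inverses_def)
  have S: "T (S (S (T x))) = S x" for x
    using Lp_projections_commute [OF p proj, of x] by (simp add: TT STS)
  have "T (S x) = S x" for x
    using S [of x] TT by metis
  moreover have "T x = S x" for x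
    using S [of "T x"] S [of x] calculation TST TT by metis
  ultimately have "(\<lambda>x. T (S x)) = T" by auto
  with proj show ?thesis by simp
qed

lemma idempotents_Lp_PIso:
  assumes p: "1 \<le> p" "p \<noteq> 2"
  shows "{T \<in> Lp_PIso p scal UNIV. compose UNIV T T = T} = Lp_projections p scal UNIV"
proof (intro equalityI subsetI)
  fix T assume T: "T \<in> {T \<in> Lp_PIso p scal UNIV. compose UNIV T T = T}"
  then obtain S where "Lp_inverses p scal T S" by (auto simp: Lp_PIso_iff)
  moreover have "T (T x) = T x" for x
    using T by (metis (mono_tags) compose_UNIV mem_Collect_eq)
  ultimately show "T \<in> Lp_projections p scal UNIV"
    by (rule Lp_inverses_idempotent [OF p])
next
  fix P assume P: "P \<in> Lp_projections p scal UNIV"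
  have "P \<in> Lp_PIso p scal UNIV"
    using Lp_projection_self_inverse [OF p(1) P] by (rule Lp_inverses_imp_PIso)
  then show "P \<in> {T \<in> Lp_PIso p scal UNIV. compose UNIV T T = T}"
    using Lp_projectionsD(2) [OF p(1) P UNIV_I] by (simp add: compose_UNIV)
qed

end

text \<open>
  A regular semigroup with commuting idempotents is inverse: if \<open>t\<close> and \<open>u\<close> are inverses of \<open>s\<close>,
  then inserting \<open>s = s u s\<close> into \<open>t = t s t\<close> and \<open>s = s t s\<close> into \<open>u = u s u\<close> and exchanging
  idempotents turns both into \<open>u s t\<close>.
\<close>
lemma inverse_semigroupI:
  assumes nonempty: "M \<noteq> {}"
    and closed: "\<And>s t. s \<in> M \<Longrightarrow> t \<in> M \<Longrightarrow> mul s t \<in> M"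
    and assoc: "\<And>s t u. s \<in> M \<Longrightarrow> t \<in> M \<Longrightarrow> u \<in> M \<Longrightarrow> mul (mul s t) u = mul s (mul t u)"
    and regular: "\<And>s. s \<in> M \<Longrightarrow> \<exists>t\<in>M. mul (mul s t) s = s \<and> mul (mul t s) t = t"
    and commute: "\<And>e f. e \<in> M \<Longrightarrow> f \<in> M \<Longrightarrow> mul e e = e \<Longrightarrow> mul f f = f \<Longrightarrow> mul e f = mul f e"
  shows "inverse_semigroup M mul"
proof -
  have unique: "t = u"
    if M: "s \<in> M" "t \<in> M" "u \<in> M"
      and t: "mul (mul s t) s = s" "mul (mul t s) t = t"
      and u: "mul (mul s u) s = s" "mul (mul u s) u = u" for s t u
  proof -
    note prods = closed [OF M(1,2)] closed [OF M(2,1)] closed [OF M(1,3)] closed [OF M(3,1)]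
    have idem: "mul (mul s t) (mul s t) = mul s t" "mul (mul t s) (mul t s) = mul t s"
      "mul (mul s u) (mul s u) = mul s u" "mul (mul u s) (mul u s) = mul u s"
      using M t u prods assoc by metis+
    have "t = mul (mul t (mul (mul s u) s)) t" by (simp add: t u)
    also have "\<dots> = mul (mul (mul t s) (mul u s)) t"
      using M prods by (simp add: assoc closed)
    also have "\<dots> = mul (mul (mul u s) (mul t s)) t"
      using commute [OF prods(2,4) idem(2,4)] by simp
    also have "\<dots> = mul (mul u (mul (mul s t) s)) t"
      using M prods by (simp add: assoc closed)
    also have "\<dots> = mul (mul u s) t" by (simp add: t)
    finally have t_eq: "t = mul (mul u s) t" .
    have "u = mul (mul u (mul (mul s t) s)) u" by (simp add: t u)
    also have "\<dots> = mul u (mul (mul s t) (mul s u))"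
      using M prods by (simp add: assoc closed)
    also have "\<dots> = mul u (mul (mul s u) (mul s t))"
      using commute [OF prods(1,3) idem(1,3)] by simp
    also have "\<dots> = mul (mul u (mul (mul s u) s)) t"
      using M prods by (simp add: assoc closed)
    also have "\<dots> = mul (mul u s) t" by (simp add: u)
    finally show ?thesis using t_eq by simp
  qed
  show ?thesis
    unfolding inverse_semigroup_def
  proof (intro conjI ballI)
    fix s assume s: "s \<in> M"
    then obtain t where "t \<in> M" "mul (mul s t) s = s" "mul (mul t s) t = t"
      using regular by blast
    then show "\<exists>!t. t \<in> M \<and> mul (mul s t) s = s \<and> mul (mul t s) t = t"
      using unique [OF s] by blast
  qed (use nonempty closed assoc in auto)
qed

context banach_space_over
begin

lemma inverse_semigroup_Lp_PIso:
  assumes p: "1 \<le> p" "p \<noteq> 2"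
  shows "inverse_semigroup (Lp_PIso p scal UNIV) (compose UNIV)"
proof (rule inverse_semigroupI)
  show "Lp_PIso p scal UNIV \<noteq> {}"
    using idempotents_Lp_PIso [OF p] identity_Lp_projection [OF p(1)] by blast
next
  fix S T assume "S \<in> Lp_PIso p scal UNIV" "T \<in> Lp_PIso p scal UNIV"
  then show "compose UNIV S T \<in> Lp_PIso p scal UNIV"
    using Lp_inverses_compose [OF p] unfolding Lp_PIso_iff compose_UNIV by blast
next
  fix T assume "T \<in> Lp_PIso p scal UNIV"
  then obtain S where "Lp_inverses p scal T S" by (auto simp: Lp_PIso_iff)
  then show "\<exists>S\<in>Lp_PIso p scal UNIV.
      compose UNIV (compose UNIV T S) T = T \<and> compose UNIV (compose UNIV S T) S = S"
    by (intro bexI [of _ S]) (auto simp: compose_UNIV Lp_inverses_imp_PIso, auto simp: Lp_inverses_def)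
next
  fix E F assume "E \<in> Lp_PIso p scal UNIV" "F \<in> Lp_PIso p scal UNIV"
    "compose UNIV E E = E" "compose UNIV F F = F"
  then have "E \<in> Lp_projections p scal UNIV" "F \<in> Lp_projections p scal UNIV"
    using idempotents_Lp_PIso [OF p] by blast+
  then show "compose UNIV E F = compose UNIV F E"
    using Lp_projections_commute [OF p] by (auto simp: compose_UNIV)
qed (simp add: compose_UNIV)

lemma adjoint_contraction:
  assumes T: "T \<in> contractions scal UNIV"
  shows "adjoint_operator scal T \<in> contractions dual_scal (dual scal)"
proof -
  have bdd: "T \<in> bounded_operators scal UNIV" and contr: "norm (T x) \<le> norm x" for x
    using T by (auto simp: contractions_def)
  have "norm (adjoint_operator scal T f) \<le> norm f" if "f \<in> dual scal" for f
  proof (rule norm_blinfun_bound)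
    fix x
    have "norm (blinfun_apply f (T x)) \<le> norm f * norm (T x)" by (rule norm_blinfun)
    also have "\<dots> \<le> norm f * norm x" by (intro mult_left_mono contr) simp
    finally show "norm (blinfun_apply (adjoint_operator scal T f) x) \<le> norm f * norm x"
      by (simp add: adjoint_operator_apply [OF bdd that])
  qed simp
  with adjoint_operator_bounded [OF bdd] show ?thesis by (simp add: contractions_def)
qed

lemma adjoint_Lp_PIso:
  assumes pq: "1 \<le> p" "1 \<le> q" "1 / p + 1 / q = 1" and T: "T \<in> Lp_PIso p scal UNIV"
  shows "adjoint_operator scal T \<in> Lp_PIso q dual_scal (dual scal)"
proof -
  obtain S where TS: "Lp_inverses p scal T S" using T by (auto simp: Lp_PIso_iff)
  let ?adj = "adjoint_operator scal" and ?mul = "compose (dual scal)"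
  have contr: "T \<in> contractions scal UNIV" "S \<in> contractions scal UNIV"
    and TST: "(\<lambda>x. T (S (T x))) = T" and STS: "(\<lambda>x. S (T (S x))) = S"
    and proj: "(\<lambda>x. T (S x)) \<in> Lp_projections p scal UNIV" "(\<lambda>x. S (T x)) \<in> Lp_projections p scal UNIV"
    using TS by (auto simp: Lp_inverses_def)
  then have bdd: "T \<in> bounded_operators scal UNIV" "S \<in> bounded_operators scal UNIV"
    by (auto simp: contractions_def)
  note bdd2 = bounded_operators_compose [OF bdd(1,2)] bounded_operators_compose [OF bdd(2,1)]
  have assoc: "?mul F (?mul G (?adj H)) = ?mul (?mul F G) (?adj H)"
    if "H \<in> bounded_operators scal UNIV" for F G H
    using bounded_operators_apply(1) [OF adjoint_operator_bounded [OF that]] by (auto simp: compose_def)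
  have "?mul (?adj T) (?mul (?adj S) (?adj T)) = ?adj T"
    using adjoint_compose [OF bdd(1) bdd2(2)] adjoint_compose [OF bdd(2,1)]
    by (simp add: assoc bdd TST)
  moreover have "?mul (?adj S) (?mul (?adj T) (?adj S)) = ?adj S"
    using adjoint_compose [OF bdd(2) bdd2(1)] adjoint_compose [OF bdd(1,2)]
    by (simp add: assoc bdd STS)
  moreover have "?mul (?adj T) (?adj S) \<in> Lp_projections q dual_scal (dual scal)"
    "?mul (?adj S) (?adj T) \<in> Lp_projections q dual_scal (dual scal)"
    using adjoint_Lp_projection [OF pq proj(1)] adjoint_Lp_projection [OF pq proj(2)]
    by (simp_all add: adjoint_compose bdd)
  ultimately show ?thesis
    using adjoint_contraction contr unfolding Lp_PIso_def by blast
qed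

lemma Lp_PIso_bounded: "T \<in> Lp_PIso p scal UNIV \<Longrightarrow> T \<in> bounded_operators scal UNIV"
  by (simp add: Lp_PIso_def contractions_def)

end

theorem proposition2p23:
  fixes scal :: "'k::real_or_complex \<Rightarrow> 'a::banach \<Rightarrow> 'a" and p :: ereal
  assumes "banach_space_over scal"
    and "1 \<le> p" and "p \<noteq> 2"
  shows "inverse_semigroup (Lp_PIso p scal UNIV) (compose UNIV) \<and>
    {T \<in> Lp_PIso p scal UNIV. compose UNIV T T = T} = Lp_projections p scal UNIV \<and>
    (\<forall>q::ereal. 1 \<le> q \<and> 1 / p + 1 / q = 1 \<longrightarrow>
      adjoint_operator scal ` Lp_PIso p scal UNIV \<subseteq> Lp_PIso q dual_scal (dual scal) \<and>
      inj_on (adjoint_operator scal) (Lp_PIso p scal UNIV) \<and>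
      (\<forall>S \<in> Lp_PIso p scal UNIV. \<forall>T \<in> Lp_PIso p scal UNIV.
        adjoint_operator scal (compose UNIV S T) =
        compose (dual scal) (adjoint_operator scal T) (adjoint_operator scal S)))"
proof -
  interpret banach_space_over scal by (rule assms(1))
  note p = assms(2,3)
  have "inj_on (adjoint_operator scal) (Lp_PIso p scal UNIV)"
    by (intro inj_onI adjoint_inject Lp_PIso_bounded)
  moreover have "adjoint_operator scal (compose UNIV S T)
      = compose (dual scal) (adjoint_operator scal T) (adjoint_operator scal S)"
    if "S \<in> Lp_PIso p scal UNIV" "T \<in> Lp_PIso p scal UNIV" for S T
    using that by (simp add: compose_UNIV adjoint_compose Lp_PIso_bounded)
  moreover have "adjoint_operator scal ` Lp_PIso p scal UNIV \<subseteq> Lp_PIso q dual_scal (dual scal)"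
    if "1 \<le> q" "1 / p + 1 / q = 1" for q
    using adjoint_Lp_PIso [OF p(1) that] by blast
  ultimately show ?thesis
    using inverse_semigroup_Lp_PIso [OF p] idempotents_Lp_PIso [OF p] by blast
qed

end
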